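(* Let $K$ be a field and let $(f_n)$ be a family of polynomials in $\mathsf{VP}$ over $K$, with $d_n=\deg(f_n)$. Then $(f_n)$ can be computed by a family $(\Gamma_n)$ of depth four circuits with $n^{O(\log d_n)}$ addition gates and $n^{O(\sqrt{d_n}\log d_n)}$ multiplication gates. The family $(f_n)$ can also be computed by a family $(F_n)$ of depth four arithmetic formulas of size $n^{O(\sqrt{d_n}\log d_n)}$. The inputs of $\Gamma_n$ and $F_n$ are variables of $f_n$ or constants, and their multiplication gates have fan-in at most $\sqrt{3d_n}+1$.
   Context: An arithmetic circuit over $K$ has input gates labelled by variables or constants of $K$, and addition and multiplication gates; its size is its number of gates. A family $(f_n)$ of polynomials over $K$ belongs to $\mathsf{VP}$ if there is a polynomial $p$ and arithmetic circuits $C_n$ such that $C_n$ computes $f_n$, has size at most $p(n)$, and $\deg(f_n)\le p(n)$. A depth four circuit is a $\Sigma\Pi\Sigma\Pi$ circuit with gates of unbounded fan-in: the output is an addition gate, whose inputs are multiplication gates, whose inputs are addition gates, whose inputs are multiplication gates taking input gates as inputs. A depth four formula is a depth four circuit in which every non-output gate has fan-out one.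
   Formalization: In the exponents, d_n is replaced by max(2, d_n), since for d_n ≤ 1 log d_n is 0 or undefined and the literal bound fails (e.g. x_1+…+x_n); the gate-count and size bounds are asserted only for n ≥ 2, as 1^{O(·)} = 1 cannot hold. *)

theory Defs
  imports
    Complex_Main
    "HOL-Library.Poly_Mapping"
    "HOL-Library.Landau_Symbols"
    "HOL-Computational_Algebra.Polynomial"
begin

text \<open>Multivariate polynomials: a monomial is a finitely supported exponent vector.\<close>

type_synonym ('v, 'k) mpoly = "('v \<Rightarrow>\<^sub>0 nat) \<Rightarrow>\<^sub>0 'k"

definition mvar :: "'v \<Rightarrow> ('v, 'k::field) mpoly" where
  "mvar x = Poly_Mapping.single (Poly_Mapping.single x 1) 1"

definition mconst :: "'k::field \<Rightarrow> ('v, 'k) mpoly" where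
  "mconst c = Poly_Mapping.single 0 c"

definition monom_degree :: "('v \<Rightarrow>\<^sub>0 nat) \<Rightarrow> nat" where
  "monom_degree m = (\<Sum>x\<in>Poly_Mapping.keys m. Poly_Mapping.lookup m x)"

text \<open>The total degree, with the convention that the zero polynomial has degree 0.\<close>

definition total_degree :: "('v, 'k::field) mpoly \<Rightarrow> nat" where
  "total_degree p = Max (insert 0 (monom_degree ` Poly_Mapping.keys p))"

definition mvars :: "('v, 'k::field) mpoly \<Rightarrow> 'v set" where
  "mvars p = (\<Union>m\<in>Poly_Mapping.keys p. Poly_Mapping.keys m)"

text \<open>
  A circuit is the list of its gates in a topological order; the arguments of a gate are positions
  of earlier gates, and the last gate is the output.  The fan-in is unbounded, and a repeated
  argument is a multiple edge.
\<close>

datatype ('v, 'k) gate = Var 'v | Const 'k | Add "nat list" | Mul "nat list"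

type_synonym ('v, 'k) circuit = "('v, 'k) gate list"

fun args :: "('v, 'k) gate \<Rightarrow> nat list" where
  "args (Var x) = []"
| "args (Const c) = []"
| "args (Add is) = is"
| "args (Mul is) = is"

fun is_input :: "('v, 'k) gate \<Rightarrow> bool" where
  "is_input (Var x) = True"
| "is_input (Const c) = True"
| "is_input (Add is) = False"
| "is_input (Mul is) = False"

fun is_add :: "('v, 'k) gate \<Rightarrow> bool" where
  "is_add (Add is) = True"
| "is_add _ = False"

fun is_mul :: "('v, 'k) gate \<Rightarrow> bool" where
  "is_mul (Mul is) = True"
| "is_mul _ = False"

definition is_circuit :: "('v, 'k) circuit \<Rightarrow> bool" where
  "is_circuit C \<longleftrightarrow> C \<noteq> [] \<and>
     (\<forall>i < length C. (\<forall>j\<in>set (args (C ! i)). j < i) \<and>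
        (\<not> is_input (C ! i) \<longrightarrow> args (C ! i) \<noteq> []))"

fun gate_value :: "('v, 'k::field) mpoly list \<Rightarrow> ('v, 'k) gate \<Rightarrow> ('v, 'k) mpoly" where
  "gate_value vs (Var x) = mvar x"
| "gate_value vs (Const c) = mconst c"
| "gate_value vs (Add is) = (\<Sum>i\<leftarrow>is. vs ! i)"
| "gate_value vs (Mul is) = (\<Prod>i\<leftarrow>is. vs ! i)"

definition circuit_values :: "('v, 'k::field) circuit \<Rightarrow> ('v, 'k) mpoly list" where
  "circuit_values C = foldl (\<lambda>vs g. vs @ [gate_value vs g]) [] C"

definition computes :: "('v, 'k::field) circuit \<Rightarrow> ('v, 'k) mpoly \<Rightarrow> bool" where
  "computes C p \<longleftrightarrow> is_circuit C \<and> last (circuit_values C) = p"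

definition circuit_size :: "('v, 'k) circuit \<Rightarrow> nat" where
  "circuit_size C = length C"

definition num_add :: "('v, 'k) circuit \<Rightarrow> nat" where
  "num_add C = length (filter is_add C)"

definition num_mul :: "('v, 'k) circuit \<Rightarrow> nat" where
  "num_mul C = length (filter is_mul C)"

definition input_vars :: "('v, 'k) circuit \<Rightarrow> 'v set" where
  "input_vars C = {x. Var x \<in> set C}"

definition fan_in :: "('v, 'k) gate \<Rightarrow> nat" where
  "fan_in g = length (args g)"

definition fan_out :: "('v, 'k) circuit \<Rightarrow> nat \<Rightarrow> nat" where
  "fan_out C i = (\<Sum>g\<leftarrow>C. count_list (args g) i)"

definition VP :: "(nat \<Rightarrow> ('v, 'k::field) mpoly) set" where
  "VP = {f. \<exists>(p :: real poly) C. \<forall>n. computes (C n) (f n) \<and>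
           real (circuit_size (C n)) \<le> poly p (real n) \<and>
           real (total_degree (f n)) \<le> poly p (real n)}"

definition depth_four_circuit :: "('v, 'k) circuit \<Rightarrow> bool" where
  "depth_four_circuit C \<longleftrightarrow> is_circuit C \<and> is_add (last C) \<and>
     (\<forall>i\<in>set (args (last C)). is_mul (C ! i) \<and>
       (\<forall>j\<in>set (args (C ! i)). is_add (C ! j) \<and>
         (\<forall>k\<in>set (args (C ! j)). is_mul (C ! k) \<and>
           (\<forall>l\<in>set (args (C ! k)). is_input (C ! l)))))"

definition depth_four_formula :: "('v, 'k) circuit \<Rightarrow> bool" where
  "depth_four_formula C \<longleftrightarrow> depth_four_circuit C \<and> (\<forall>i < length C - 1. fan_out C i = 1)"

text \<open>
  In the bounds, a degree 0 or 1 is read as 2: there \<open>log d\<close> is undefined or zero, and a bound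
  \<open>n\<^sup>0 = 1\<close> on the number of gates would be unsatisfiable.
\<close>

definition deg2 :: "('v, 'k::field) mpoly \<Rightarrow> real" where
  "deg2 p = max 2 (real (total_degree p))"

end

theory Submission
  imports Defs "HOL-Library.Multiset"
begin

text \<open>
  Up to degree \<open>D\<close>, the homogeneous parts of all gates of a circuit lie in the span of polynomially
  many homogeneous polynomials, each of which, in degree at least two, is a linear combination of
  products of two others of smaller degree.  Expand a homogeneous polynomial with a pushdown stack:
  the polynomial on top is replaced by a product, the lighter factor on top of the heavier one, until
  a linear form is on top, which is emitted.  The degree on top halves whenever the stack grows, so
  stacks have logarithmic height and there are only \<open>n ^ O(log d)\<close> of them: this is an algebraic
  branching program.  Cutting its runs into at most \<open>t + 1\<close> segments of length
  \<open>t = \<lfloor>sqrt (3 * d)\<rfloor>\<close> writes \<open>f\<close> as a sum of products of segment polynomials, of degree at most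
  \<open>t\<close>, and these are written as sums of monomials.
\<close>

section \<open>Homogeneous parts\<close>

text \<open>Size counts gates only: arguments of a multiplication gate may repeat, and gates may
  have huge degree or contain variables that cancel in f. So the circuit itself is not normalised;
  only the spans of the truncated homogeneous parts of its gates are tracked, restricted to the
  variables \<open>V\<close> of f. A part of degree 0 is a scalar, so in a product of two gates the
  terms containing it stay in the span, and the remaining terms have two factors of strictly smaller
  positive degree. The two gate counts differ by what is shared. A segment polynomial is fixed by
  its degree level and its end states, so one addition gate for each needs only polynomially many in
  the number of states. A product of segments is a sequence of up to t intermediate states, and a
  segment polynomial has up to n ^ O(t) monomials; this brings the square root into the exponent.
  The 3 under the root gives d \<le> t * (t + 1) for every d, so that t + 1 segments suffice. The
  bottom products have the same fan-in t + 1: at most t variables and a coefficient.\<close>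

definition hcomp :: "'v set \<Rightarrow> nat \<Rightarrow> ('v, 'k::field) mpoly \<Rightarrow> ('v, 'k) mpoly" where
  "hcomp V d p = Abs_poly_mapping
     (\<lambda>m. Poly_Mapping.lookup p m when monom_degree m = d \<and> Poly_Mapping.keys m \<subseteq> V)"

definition homog :: "'v set \<Rightarrow> nat \<Rightarrow> ('v, 'k::field) mpoly \<Rightarrow> bool" where
  "homog V d p \<longleftrightarrow>
     (\<forall>m\<in>Poly_Mapping.keys p. monom_degree m = d \<and> Poly_Mapping.keys m \<subseteq> V)"

lemma lookup_hcomp:
  "Poly_Mapping.lookup (hcomp V d p) m =
     (Poly_Mapping.lookup p m when monom_degree m = d \<and> Poly_Mapping.keys m \<subseteq> V)"
proof -
  have "finite {m. (Poly_Mapping.lookup p m when monom_degree m = d \<and> Poly_Mapping.keys m \<subseteq> V) \<noteq> 0}"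
    by (rule finite_subset[OF _ finite_lookup[of p]]) auto
  then show ?thesis
    by (simp add: hcomp_def)
qed

lemma lookup_mconst_mult:
  "Poly_Mapping.lookup (mconst c * p) m = c * Poly_Mapping.lookup p m"
  by (simp add: mconst_def lookup_mult lookup_single when_mult)

lemma mconst_add: "mconst (a + b) = mconst a + mconst b"
  by (simp add: mconst_def single_add)

lemma mconst_mult: "mconst (a * b) = mconst a * mconst b"
  by (simp add: mconst_def mult_single)

lemma mconst_0 [simp]: "mconst 0 = 0"
  by (simp add: mconst_def)

lemma mconst_1 [simp]: "mconst 1 = 1"
  by (simp add: mconst_def)

lemma mconst_power: "mconst (a ^ n) = mconst a ^ n"
  by (induction n) (simp_all add: mconst_mult)

lemma mconst_of_nat: "mconst (of_nat n) = of_nat n"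
  by (simp add: mconst_def)

lemma monom_degree_superset:
  assumes "finite A" "Poly_Mapping.keys m \<subseteq> A"
  shows "monom_degree m = (\<Sum>x\<in>A. Poly_Mapping.lookup m x)"
  unfolding monom_degree_def
  by (rule sum.mono_neutral_left) (use assms in \<open>auto simp: in_keys_iff\<close>)

lemma monom_degree_add: "monom_degree (m + m') = monom_degree m + monom_degree m'"
proof -
  let ?A = "Poly_Mapping.keys m \<union> Poly_Mapping.keys m'"
  have "monom_degree (m + m') = (\<Sum>x\<in>?A. Poly_Mapping.lookup (m + m') x)"
    by (rule monom_degree_superset) (use keys_add[of m m'] in auto)
  also have "\<dots> = (\<Sum>x\<in>?A. Poly_Mapping.lookup m x) + (\<Sum>x\<in>?A. Poly_Mapping.lookup m' x)"
    by (simp add: lookup_add sum.distrib)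
  also have "\<dots> = monom_degree m + monom_degree m'"
    by (simp add: monom_degree_superset[where A = ?A])
  finally show ?thesis .
qed

lemma keys_monom_add:
  "Poly_Mapping.keys (m + m' :: 'v \<Rightarrow>\<^sub>0 nat) = Poly_Mapping.keys m \<union> Poly_Mapping.keys m'"
  by (auto simp: in_keys_iff lookup_add)

lemma monom_degree_zero [simp]: "monom_degree 0 = 0"
  by (simp add: monom_degree_def)

lemma monom_degree_single [simp]: "monom_degree (Poly_Mapping.single x n) = n"
  by (simp add: monom_degree_def)

lemma monom_degree_eq_0_iff [simp]: "monom_degree m = 0 \<longleftrightarrow> m = 0"
proof
  assume "monom_degree m = 0"
  then have "Poly_Mapping.lookup m x = 0" for x
    by (auto simp: monom_degree_def in_keys_iff)
  then show "m = 0"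
    by (intro poly_mapping_eqI) simp
qed simp

lemma hcomp_add: "hcomp V d (p + q) = hcomp V d p + hcomp V d q"
  by (rule poly_mapping_eqI) (simp add: lookup_hcomp lookup_add when_add_distrib)

lemma hcomp_zero [simp]: "hcomp V d 0 = 0"
  by (rule poly_mapping_eqI) (simp add: lookup_hcomp)

lemma hcomp_diff: "hcomp V d (p - q) = hcomp V d p - hcomp V d q"
  by (rule poly_mapping_eqI) (simp add: lookup_hcomp lookup_minus when_diff_distrib)

lemma hcomp_sum: "hcomp V d (sum g A) = (\<Sum>x\<in>A. hcomp V d (g x))"
  by (induction A rule: infinite_finite_induct) (simp_all add: hcomp_add)

lemma hcomp_mconst_mult: "hcomp V d (mconst c * p) = mconst c * hcomp V d p"
  by (rule poly_mapping_eqI) (simp add: lookup_hcomp lookup_mconst_mult mult_when)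

lemma hcomp_single:
  "hcomp V d (Poly_Mapping.single m c) =
     (if monom_degree m = d \<and> Poly_Mapping.keys m \<subseteq> V then Poly_Mapping.single m c else 0)"
  by (rule poly_mapping_eqI) (auto simp: lookup_hcomp lookup_single when_def)

lemma mpoly_induct [case_names zero single add]:
  fixes p :: "('v, 'k::field) mpoly"
  assumes "Q 0" "\<And>m c. Q (Poly_Mapping.single m c)" "\<And>p q. Q p \<Longrightarrow> Q q \<Longrightarrow> Q (p + q)"
  shows "Q p"
proof (induction p rule: update_induct)
  case const
  then show ?case by (simp add: assms)
next
  case (update p m c)
  have "Poly_Mapping.update m c p = Poly_Mapping.single m c + p"
    by (rule poly_mapping_eqI)
      (use update in \<open>auto simp: lookup_update lookup_add lookup_single not_in_keys_iff_lookup_eq_zero\<close>)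
  then show ?case
    using update assms by simp
qed

text \<open>By bilinearity it is enough to compare two monomials, where only
  \<open>i = monom_degree m\<close> contributes. The support condition splits over the factors
  because natural exponents cannot cancel: restricting to \<open>V\<close> is the substitution of 0
  for all other variables, hence multiplicative.\<close>

lemma hcomp_mult: "hcomp V d (p * q) = (\<Sum>i\<le>d. hcomp V i p * hcomp V (d - i) q)"
proof (induction p rule: mpoly_induct)
  case zero
  then show ?case by simp
next
  case (add p p')
  then show ?case by (simp add: hcomp_add distrib_right sum.distrib)
next
  case (single m c)
  show ?case
  proof (induction q rule: mpoly_induct)
    case zero
    then show ?case by simp
  next
    case (add p p')
    then show ?case by (simp add: hcomp_add distrib_left sum.distrib)
  next
    case (single m' c')
    have "(\<Sum>i\<le>d. hcomp V i (Poly_Mapping.single m c) * hcomp V (d - i) (Poly_Mapping.single m' c'))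
      = (\<Sum>i\<le>d. if i = monom_degree m then
            (if monom_degree m' = d - i \<and> Poly_Mapping.keys m \<subseteq> V \<and> Poly_Mapping.keys m' \<subseteq> V
             then Poly_Mapping.single (m + m') (c * c') else 0) else 0)"
      by (rule sum.cong) (auto simp: hcomp_single mult_single)
    also have "\<dots> = hcomp V d (Poly_Mapping.single m c * Poly_Mapping.single m' c')"
      by (auto simp: mult_single hcomp_single monom_degree_add keys_monom_add)
    finally show ?case by simp
  qed
qed

lemma homog_hcomp: "homog V d (hcomp V d p)"
  by (auto simp: homog_def in_keys_iff lookup_hcomp)

lemma homog_zero [simp]: "homog V d 0"
  by (simp add: homog_def)

lemma homog_one [simp]: "homog V 0 1"
  by (simp add: homog_def)

lemma homog_mconst [simp]: "homog V 0 (mconst c)"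
  by (simp add: homog_def mconst_def)

lemma homog_add: "homog V d p \<Longrightarrow> homog V d q \<Longrightarrow> homog V d (p + q)"
  using keys_add[of p q] by (auto simp: homog_def)

lemma homog_sum: "(\<And>x. x \<in> A \<Longrightarrow> homog V d (g x)) \<Longrightarrow> homog V d (sum g A)"
  by (induction A rule: infinite_finite_induct) (simp_all add: homog_add)

lemma homog_mult: "homog V d p \<Longrightarrow> homog V e q \<Longrightarrow> homog V (d + e) (p * q)"
  using keys_mult[of p q] by (fastforce simp: homog_def monom_degree_add keys_monom_add)

lemma hcomp_0_eq: "hcomp V 0 p = mconst (Poly_Mapping.lookup p 0)"
  by (rule poly_mapping_eqI) (auto simp: lookup_hcomp mconst_def lookup_single when_def)

lemma hcomp_mconst: "0 < d \<Longrightarrow> hcomp V d (mconst c) = 0"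
  by (auto simp: mconst_def hcomp_single)

lemma hcomp_mvar: "d \<noteq> 1 \<Longrightarrow> hcomp V d (mvar x) = 0"
  by (auto simp: mvar_def hcomp_single)

lemma monom_degree_le_total_degree: "m \<in> Poly_Mapping.keys p \<Longrightarrow> monom_degree m \<le> total_degree p"
  unfolding total_degree_def by (rule Max_ge) auto

lemma sum_hcomp:
  assumes "total_degree p \<le> d" "mvars p \<subseteq> V"
  shows "p = (\<Sum>i\<le>d. hcomp V i p)"
proof (rule poly_mapping_eqI)
  fix m
  show "Poly_Mapping.lookup p m = Poly_Mapping.lookup (\<Sum>i\<le>d. hcomp V i p) m"
  proof (cases "m \<in> Poly_Mapping.keys p")
    case True
    then have "monom_degree m \<le> d" "Poly_Mapping.keys m \<subseteq> V"
      using assms monom_degree_le_total_degree[OF True] by (auto simp: mvars_def)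
    then have "(\<Sum>i\<le>d. Poly_Mapping.lookup (hcomp V i p) m)
        = (\<Sum>i\<le>d. if i = monom_degree m then Poly_Mapping.lookup p m else 0)"
      by (intro sum.cong) (auto simp: lookup_hcomp)
    also have "\<dots> = Poly_Mapping.lookup p m"
      using \<open>monom_degree m \<le> d\<close> by simp
    finally show ?thesis by (simp add: lookup_sum)
  qed (simp add: lookup_sum lookup_hcomp in_keys_iff)
qed

text \<open>Scalars act as constant polynomials, so that \<open>mp.span\<close> speaks of
  combinations over the field inside the ring itself.\<close>

interpretation mp: vector_space "\<lambda>c (p :: ('v, 'k::field) mpoly). mconst c * p"
  by standard (simp_all add: mconst_add mconst_mult algebra_simps)

section \<open>Families closed under quadratic decomposition\<close>

definition products :: "(nat \<Rightarrow> ('v, 'k::field) mpoly set) \<Rightarrow> nat \<Rightarrow> ('v, 'k) mpoly set" where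
  "products B d = {p * q | p q i. 0 < i \<and> i < d \<and> p \<in> B i \<and> q \<in> B (d - i)}"

text \<open>\<open>S\<close> bounds each degree separately, and the number of terms in a
  decomposition is left free: the later count is one of states, not of terms. Both factors in
  \<open>products\<close> have positive degree, so each is of strictly smaller degree than the
  product.\<close>

definition quad_family :: "'v set \<Rightarrow> nat \<Rightarrow> (nat \<Rightarrow> ('v, 'k::field) mpoly set) \<Rightarrow> bool" where
  "quad_family V S B \<longleftrightarrow>
     (\<forall>d. finite (B d) \<and> card (B d) \<le> S \<and> (\<forall>b\<in>B d. homog V d b)) \<and>
     (\<forall>d\<ge>2. B d \<subseteq> mp.span (products B d))"

text \<open>Degree 0 is left out because a constant part can be absorbed as a scalar, degrees above
  \<open>D\<close> because they never contribute to components of degree at most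
  \<open>D\<close>.\<close>

definition spanned :: "'v set \<Rightarrow> nat \<Rightarrow> (nat \<Rightarrow> ('v, 'k::field) mpoly set) \<Rightarrow> ('v, 'k) mpoly \<Rightarrow> bool" where
  "spanned V D B h \<longleftrightarrow> (\<forall>d\<in>{1..D}. hcomp V d h \<in> mp.span (B d))"

text \<open>The gate values of a circuit enter \<open>H\<close> one at a time, while
  \<open>S\<close> records how many members per degree have been spent on them.\<close>

definition generable :: "'v set \<Rightarrow> nat \<Rightarrow> nat \<Rightarrow> ('v, 'k::field) mpoly set \<Rightarrow> bool" where
  "generable V D S H \<longleftrightarrow> (\<exists>B. quad_family V S B \<and> (\<forall>h\<in>H. spanned V D B h))"

lemma products_mono: "(\<And>d. B d \<subseteq> B' d) \<Longrightarrow> products B d \<subseteq> products B' d"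
  unfolding products_def by blast

lemma quad_family_insert:
  assumes "quad_family V S B" "\<And>d. homog V d (b d)"
    and "\<And>d. 2 \<le> d \<Longrightarrow> b d \<in> mp.span (products B d)"
  shows "quad_family V (S + 1) (\<lambda>d. insert (b d) (B d))"
proof -
  have "mp.span (products B d) \<subseteq> mp.span (products (\<lambda>d. insert (b d) (B d)) d)" for d
    by (intro mp.span_mono products_mono) auto
  moreover have "card (insert (b d) (B d)) \<le> S + 1" for d
    using assms(1) by (auto simp: quad_family_def card_insert_if intro: le_SucI)
  ultimately show ?thesis
    using assms unfolding quad_family_def by (auto simp del: insert_subset) blast+
qed

lemma spanned_mono:
  assumes "spanned V D B h" "\<And>d. B d \<subseteq> B' d"
  shows "spanned V D B' h"
  using assms mp.span_mono unfolding spanned_def by blast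

lemma span_mult_products:
  assumes "p \<in> mp.span (B i)" "q \<in> mp.span (B (d - i))" "0 < i" "i < d"
  shows "p * q \<in> mp.span (products B d)"
  using assms(1)
proof (induction rule: mp.span_induct_alt)
  case base
  then show ?case by (simp add: mp.span_zero)
next
  case (step c x y)
  have "x * q \<in> mp.span (products B d)"
    using assms(2)
  proof (induction rule: mp.span_induct_alt)
    case base
    then show ?case by (simp add: mp.span_zero)
  next
    case (step c' x' y')
    have "x * x' \<in> mp.span (products B d)"
      using \<open>x \<in> B i\<close> step assms by (intro mp.span_base) (auto simp: products_def)
    then have "mconst c' * (x * x') + x * y' \<in> mp.span (products B d)"
      using step by (intro mp.span_add mp.span_scale)
    then show ?case by (simp add: algebra_simps)
  qed
  then have "mconst c * (x * q) + y * q \<in> mp.span (products B d)"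
    using step by (intro mp.span_add mp.span_scale)
  then show ?case by (simp add: algebra_simps)
qed

lemma spanned_add: "spanned V D B p \<Longrightarrow> spanned V D B q \<Longrightarrow> spanned V D B (p + q)"
  by (simp add: spanned_def hcomp_add mp.span_add)

lemma spanned_mconst: "spanned V D B (mconst c)"
  by (auto simp: spanned_def hcomp_mconst mp.span_zero)

lemma spanned_scale: "spanned V D B p \<Longrightarrow> spanned V D B (mconst c * p)"
  by (auto simp: spanned_def hcomp_mconst_mult intro: mp.span_scale)

lemma spanned_sum: "(\<And>x. x \<in> A \<Longrightarrow> spanned V D B (g x)) \<Longrightarrow> spanned V D B (sum g A)"
  by (auto simp: spanned_def hcomp_sum intro!: mp.span_sum)

lemma spanned_sum_list: "(\<And>x. x \<in> set xs \<Longrightarrow> spanned V D B (g x)) \<Longrightarrow> spanned V D B (\<Sum>x\<leftarrow>xs. g x)"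
  using spanned_mconst[of V D B 0] by (induction xs) (auto simp: spanned_add)

lemma generable_mono: "generable V D S H \<Longrightarrow> H' \<subseteq> H \<Longrightarrow> S \<le> S' \<Longrightarrow> generable V D S' H'"
  unfolding generable_def quad_family_def by (meson le_trans subsetD)

text \<open>Linear operations are free: what is already in the span of the family needs no new
  member.\<close>

lemma generable_insert_spanned:
  assumes "generable V D S H" "\<And>B. (\<And>h. h \<in> H \<Longrightarrow> spanned V D B h) \<Longrightarrow> spanned V D B p"
  shows "generable V D S (insert p H)"
  using assms unfolding generable_def by blast

lemma generable_insert:
  assumes B: "quad_family V S B" "\<And>h. h \<in> H \<Longrightarrow> spanned V D B h"
    and b: "\<And>d. homog V d (b d)" "\<And>d. 2 \<le> d \<Longrightarrow> b d \<in> mp.span (products B d)"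
    and p: "spanned V D (\<lambda>d. insert (b d) (B d)) p"
  shows "generable V D (S + 1) (insert p H)"
proof -
  have "spanned V D (\<lambda>d. insert (b d) (B d)) h" if "h \<in> H" for h
    by (rule spanned_mono[OF B(2)[OF that]]) auto
  then show ?thesis
    using quad_family_insert[OF B(1) b] p unfolding generable_def by blast
qed

lemma generable_mvar:
  assumes "generable V D S H"
  shows "generable V D (S + 1) (insert (mvar x) H)"
proof -
  obtain B where B: "quad_family V S B" "\<And>h. h \<in> H \<Longrightarrow> spanned V D B h"
    using assms unfolding generable_def by blast
  show ?thesis
  proof (rule generable_insert[OF B, where b = "\<lambda>d. hcomp V d (mvar x)"])
    show "homog V d (hcomp V d (mvar x))" for d
      by (rule homog_hcomp)
    show "hcomp V d (mvar x) \<in> mp.span (products B d)" if "2 \<le> d" for d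
      using that by (simp add: hcomp_mvar mp.span_zero)
    show "spanned V D (\<lambda>d. insert (hcomp V d (mvar x)) (B d)) (mvar x)"
      by (auto simp: spanned_def intro: mp.span_base)
  qed auto
qed

text \<open>Only the mixed terms of \<open>hcomp_mult\<close> need a new member, one in each degree.
  The two extreme terms are components of \<open>p\<close> and \<open>q\<close>, each times the
  constant term of the other factor, so they are in the span already.\<close>

lemma generable_mult:
  assumes "generable V D S H" "p \<in> H" "q \<in> H"
  shows "generable V D (S + 1) (insert (p * q) H)"
proof -
  obtain B where B: "quad_family V S B" "\<And>h. h \<in> H \<Longrightarrow> spanned V D B h"
    using assms unfolding generable_def by blast
  \<comment> \<open>Above \<open>D\<close> nothing is known about the components of \<open>p\<close>
    and \<open>q\<close>, so the new member is 0 there; 0 lies in every span.\<close>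
  define b where "b d = (if d \<le> D then \<Sum>i\<in>{1..<d}. hcomp V i p * hcomp V (d - i) q else 0)" for d
  show ?thesis
  proof (rule generable_insert[OF B, where b = b])
    show "homog V d (b d)" for d
    proof -
      have "homog V d (hcomp V i p * hcomp V (d - i) q)" if "i \<in> {1..<d}" for i
        using homog_mult[OF homog_hcomp[of V i p] homog_hcomp[of V "d - i" q]] that by simp
      then show ?thesis
        by (auto simp: b_def intro!: homog_sum)
    qed
    show "b d \<in> mp.span (products B d)" if "2 \<le> d" for d
    proof (cases "d \<le> D")
      case True
      have "hcomp V i p * hcomp V (d - i) q \<in> mp.span (products B d)" if "i \<in> {1..<d}" for i
      proof -
        have "i \<in> {1..D}" "d - i \<in> {1..D}"
          using that True by auto
        then show ?thesis
          using B(2)[OF assms(2)] B(2)[OF assms(3)] that unfolding spanned_def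
          by (intro span_mult_products[where i = i]) auto
      qed
      then show ?thesis
        by (auto simp: b_def True intro: mp.span_sum)
    qed (simp add: b_def mp.span_zero)
    show "spanned V D (\<lambda>d. insert (b d) (B d)) (p * q)"
      unfolding spanned_def
    proof
      fix d assume d: "d \<in> {1..D}"
      then have "{..d} = insert 0 (insert d {1..<d})"
        by auto
      then have "hcomp V d (p * q) = mconst (Poly_Mapping.lookup p 0) * hcomp V d q
          + (mconst (Poly_Mapping.lookup q 0) * hcomp V d p + b d)"
        using d by (simp add: hcomp_mult b_def hcomp_0_eq mult.commute)
      moreover have "hcomp V d h \<in> mp.span (insert (b d) (B d))" if "h \<in> H" for h
        using B(2)[OF that] d mp.span_mono[OF subset_insertI[of "B d" "b d"]]
        unfolding spanned_def by blast
      ultimately show "hcomp V d (p * q) \<in> mp.span (insert (b d) (B d))"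
        using assms by (simp add: mp.span_add mp.span_scale mp.span_base)
    qed
  qed auto
qed

text \<open>Each factor without constant term contributes degree at least 1.\<close>

lemma hcomp_power_eq_0:
  assumes "hcomp V 0 h = 0" "d < k"
  shows "hcomp V d (h ^ k) = 0"
  using assms(2)
proof (induction k arbitrary: d)
  case (Suc k)
  have "hcomp V i h * hcomp V (d - i) (h ^ k) = 0" if "i \<le> d" for i
    using that Suc assms(1) by (cases "i = 0") auto
  then show ?case
    by (simp add: hcomp_mult)
qed simp

text \<open>\<open>h ^ 0\<close> and \<open>h ^ 1\<close> cost nothing, each further power one
  multiplication.\<close>

lemma generable_powers:
  assumes "generable V D S H" "h \<in> H"
  shows "generable V D (S + n) (H \<union> {h ^ k | k. k \<le> Suc n})"
proof (induction n)
  case 0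
  have "generable V D S (insert 1 H)"
    by (rule generable_insert_spanned[OF assms(1)]) (use spanned_mconst[of V D _ 1] in simp)
  moreover have "H \<union> {h ^ k | k. k \<le> Suc 0} \<subseteq> insert 1 H"
    using assms(2) by (auto simp: le_Suc_eq)
  ultimately show ?case
    by (auto intro: generable_mono)
next
  case (Suc n)
  have "generable V D (S + n + 1) (insert (h * h ^ Suc n) (H \<union> {h ^ k | k. k \<le> Suc n}))"
    by (rule generable_mult[OF Suc]) (use assms(2) in blast)+
  then show ?case
    by (rule generable_mono) (auto simp: le_Suc_eq)
qed

text \<open>The cost does not depend on the exponent: modulo degree \<open>> D\<close>, a power of \<open>h\<close> is a linear
  combination of the first \<open>D\<close> powers of \<open>h\<close> minus its constant term.\<close>

lemma generable_power:
  assumes "generable V D S H" "h \<in> H"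
  shows "generable V D (S + D) (insert (h ^ n) H)"
proof -
  define c where "c = Poly_Mapping.lookup h 0"
  define h' where "h' = h - mconst c"
  have h: "h = h' + mconst c"
    by (simp add: h'_def)
  have "hcomp V 0 h' = 0"
    by (simp add: h'_def c_def hcomp_diff hcomp_0_eq mconst_def)
  have "h' = h + mconst (- c) * 1"
    by (simp add: h'_def mconst_def single_uminus)
  then have "generable V D S (insert h' H)"
    using assms by (intro generable_insert_spanned[OF assms(1)])
      (metis spanned_add mult.right_neutral spanned_mconst)
  then have "generable V D (S + D) (insert h' H \<union> {h' ^ k | k. k \<le> Suc D})"
    by (rule generable_powers) simp
  then have "generable V D (S + D) (insert (h ^ n) (insert h' H \<union> {h' ^ k | k. k \<le> Suc D}))"
  proof (rule generable_insert_spanned)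
    fix B
    assume *: "\<And>p. p \<in> insert h' H \<union> {h' ^ k | k. k \<le> Suc D} \<Longrightarrow> spanned V D B p"
    have "spanned V D B (h' ^ k)" for k
    proof (cases "k \<le> Suc D")
      case False
      then have "hcomp V d (h' ^ k) = 0" if "d \<in> {1..D}" for d
        using that by (intro hcomp_power_eq_0[OF \<open>hcomp V 0 h' = 0\<close>]) auto
      then show ?thesis
        by (simp add: spanned_def mp.span_zero)
    qed (use * in blast)
    then have "spanned V D B (\<Sum>k\<le>n. mconst (of_nat (n choose k) * c ^ (n - k)) * h' ^ k)"
      by (intro spanned_sum spanned_scale)
    also have "(\<Sum>k\<le>n. mconst (of_nat (n choose k) * c ^ (n - k)) * h' ^ k) = h ^ n"
      unfolding h binomial_ring
      by (simp add: mconst_mult mconst_power mconst_of_nat mult_ac)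
    finally show "spanned V D B (h ^ n)" .
  qed
  then show ?thesis
    by (rule generable_mono) auto
qed

text \<open>A factor costs \<open>D\<close> for its power and 1 for multiplying it to the product of
  the others.\<close>

lemma generable_prod:
  assumes "generable V D S H" "finite A" "g ` A \<subseteq> H"
  shows "generable V D (S + card A * (D + 1)) (insert (\<Prod>x\<in>A. g x ^ e x) H)"
  using assms(2,3)
proof (induction A rule: finite_induct)
  case empty
  show ?case
    by (simp, rule generable_insert_spanned[OF assms(1)]) (use spanned_mconst[of V D _ 1] in simp)
next
  case (insert x A)
  let ?p = "\<Prod>x\<in>A. g x ^ e x"
  have "generable V D (S + card A * (D + 1)) (insert ?p H)"
    using insert by simp
  then have "generable V D (S + card A * (D + 1) + D) (insert (g x ^ e x) (insert ?p H))"
    by (rule generable_power) (use insert in auto)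
  then have "generable V D (S + card A * (D + 1) + D + 1)
      (insert (g x ^ e x * ?p) (insert (g x ^ e x) (insert ?p H)))"
    by (rule generable_mult) auto
  then show ?case
    by (rule generable_mono) (use insert in auto)
qed

text \<open>Merging equal arguments bounds the number of factors of a multiplication gate by the
  number of earlier gates; its fan-in with multiplicity is unrelated to the circuit size.\<close>

lemma prod_list_eq_prod_count:
  fixes g :: "'a \<Rightarrow> 'b::comm_monoid_mult"
  assumes "finite A" "set xs \<subseteq> A"
  shows "(\<Prod>x\<leftarrow>xs. g x) = (\<Prod>x\<in>A. g x ^ count_list xs x)"
  using assms(2)
proof (induction xs)
  case (Cons y ys)
  have "(\<Prod>x\<in>A. g x ^ count_list (y # ys) x)
      = (\<Prod>x\<in>A. (if x = y then g x else 1) * g x ^ count_list ys x)"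
    by (intro prod.cong) auto
  also have "\<dots> = g y * (\<Prod>x\<in>A. g x ^ count_list ys x)"
    using Cons assms(1) by (simp add: prod.distrib)
  finally show ?case
    using Cons by simp
qed simp

section \<open>Arithmetic circuits\<close>

definition wf_gates :: "('v, 'k) circuit \<Rightarrow> bool" where
  "wf_gates C \<longleftrightarrow> (\<forall>i<length C. \<forall>j\<in>set (args (C ! i)). j < i)"

lemma circuit_values_Nil [simp]: "circuit_values [] = []"
  by (simp add: circuit_values_def)

lemma circuit_values_snoc:
  "circuit_values (C @ [g]) = circuit_values C @ [gate_value (circuit_values C) g]"
  by (simp add: circuit_values_def)

lemma length_circuit_values [simp]: "length (circuit_values C) = length C"
  by (induction C rule: rev_induct) (simp_all add: circuit_values_snoc)

lemma wf_gates_snoc: "wf_gates (C @ [g]) \<longleftrightarrow> wf_gates C \<and> (\<forall>j\<in>set (args g). j < length C)"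
  by (auto simp: wf_gates_def nth_append less_Suc_eq)

lemma gate_value_cong:
  "(\<And>j. j \<in> set (args g) \<Longrightarrow> vs ! j = ws ! j) \<Longrightarrow> gate_value vs g = gate_value ws g"
  by (cases g) (auto intro!: arg_cong[where f = sum_list] arg_cong[where f = prod_list])

lemma circuit_values_nth:
  assumes "wf_gates C" "i < length C"
  shows "circuit_values C ! i = gate_value (circuit_values C) (C ! i)"
  using assms
proof (induction C rule: rev_induct)
  case (snoc g C)
  have "gate_value (circuit_values C) ((C @ [g]) ! i) = gate_value (circuit_values (C @ [g])) ((C @ [g]) ! i)"
  proof (rule gate_value_cong)
    fix j assume "j \<in> set (args ((C @ [g]) ! i))"
    then have "j < length C"
      using snoc.prems by (fastforce simp: wf_gates_snoc wf_gates_def less_Suc_eq nth_append)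
    then show "circuit_values C ! j = circuit_values (C @ [g]) ! j"
      by (simp add: circuit_values_snoc nth_append)
  qed
  then show ?case
    using snoc by (auto simp: wf_gates_snoc circuit_values_snoc nth_append less_Suc_eq)
qed simp

lemma generable_empty: "generable V D 0 {}"
  unfolding generable_def by (rule exI[of _ "\<lambda>_. {}"]) (simp add: quad_family_def)

text \<open>A gate preceded by \<open>n\<close> others is charged at most
  \<open>n * (D + 1) + 1\<close>: additions and constants are free, a variable costs 1, a
  multiplication \<open>D + 1\<close> for each of at most \<open>n\<close> distinct
  arguments.\<close>

lemma generable_circuit:
  assumes "wf_gates C"
  shows "generable V D (length C * (length C * (D + 1) + 1)) (set (circuit_values C))"
  using assms
proof (induction C rule: rev_induct)
  case Nil
  then show ?case by (simp add: generable_empty)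
next
  case (snoc g C)
  define n S vs where "n = length C" and "S = n * (n * (D + 1) + 1)" and "vs = circuit_values C"
  have IH: "generable V D S (set vs)" and args: "\<And>j. j \<in> set (args g) \<Longrightarrow> j < n"
    using snoc by (auto simp: wf_gates_snoc n_def S_def vs_def)
  have vs: "vs ! j \<in> set vs" if "j < n" for j
    using that by (simp add: vs_def n_def)
  have "generable V D (S + n * (D + 1) + 1) (insert (gate_value vs g) (set vs))"
  proof (cases g)
    case (Var x)
    then show ?thesis
      using generable_mvar[OF IH, of x] by (auto intro: generable_mono)
  next
    case (Const c)
    have "generable V D S (insert (mconst c) (set vs))"
      by (rule generable_insert_spanned[OF IH]) (rule spanned_mconst)
    with Const show ?thesis
      by (auto intro: generable_mono)
  next
    case (Add js)
    have "generable V D S (insert (\<Sum>j\<leftarrow>js. vs ! j) (set vs))"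
      using args vs Add by (intro generable_insert_spanned[OF IH] spanned_sum_list) auto
    with Add show ?thesis
      by (auto intro: generable_mono)
  next
    case (Mul js)
    have "generable V D (S + card {..<n} * (D + 1))
        (insert (\<Prod>j\<in>{..<n}. vs ! j ^ count_list js j) (set vs))"
      by (rule generable_prod[OF IH]) (use vs in auto)
    also have "(\<Prod>j\<in>{..<n}. vs ! j ^ count_list js j) = (\<Prod>j\<leftarrow>js. vs ! j)"
      using args Mul by (intro prod_list_eq_prod_count[symmetric]) auto
    finally show ?thesis
      using Mul by (auto intro: generable_mono)
  qed
  then show ?case
    by (rule generable_mono)
      (auto simp: circuit_values_snoc vs_def S_def n_def algebra_simps)
qed

lemma mvars_add: "mvars (p + q) \<subseteq> mvars p \<union> mvars q"
  using keys_add[of p q] by (auto simp: mvars_def)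

lemma mvars_mult: "mvars (p * q) \<subseteq> mvars p \<union> mvars q"
  using keys_mult[of p q] by (fastforce simp: mvars_def keys_monom_add)

lemma mvars_sum_list: "mvars (\<Sum>x\<leftarrow>xs. g x) \<subseteq> (\<Union>x\<in>set xs. mvars (g x))"
proof (induction xs)
  case (Cons x xs)
  then show ?case using mvars_add[of "g x" "\<Sum>x\<leftarrow>xs. g x"] by auto
qed (simp add: mvars_def)

lemma mvars_prod_list: "mvars (\<Prod>x\<leftarrow>xs. g x) \<subseteq> (\<Union>x\<in>set xs. mvars (g x))"
proof (induction xs)
  case (Cons x xs)
  then show ?case using mvars_mult[of "g x" "\<Prod>x\<leftarrow>xs. g x"] by auto
qed (simp add: mvars_def)

lemma mvars_circuit_values:
  assumes "wf_gates C" "p \<in> set (circuit_values C)"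
  shows "mvars p \<subseteq> input_vars C"
  using assms
proof (induction C arbitrary: p rule: rev_induct)
  case (snoc g C)
  let ?vs = "circuit_values C"
  have mono: "input_vars C \<subseteq> input_vars (C @ [g])"
    by (auto simp: input_vars_def)
  have vs: "mvars (?vs ! j) \<subseteq> input_vars (C @ [g])" if "j \<in> set (args g)" for j
    using snoc that mono by (force simp: wf_gates_snoc)
  have "mvars (gate_value ?vs g) \<subseteq> input_vars (C @ [g])"
  proof (cases g)
    case (Add js)
    then show ?thesis using vs mvars_sum_list[of "(!) ?vs" js] by fastforce
  next
    case (Mul js)
    then show ?thesis using vs mvars_prod_list[of "(!) ?vs" js] by fastforce
  qed (auto simp: mvars_def mvar_def mconst_def input_vars_def)
  then show ?case
    using snoc mono by (auto simp: circuit_values_snoc wf_gates_snoc)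
qed simp

text \<open>Every variable of \<open>p\<close> labels an input gate. The number of variables, and
  with it later the number of monomials of bounded degree, is thus controlled by the circuit
  size.\<close>

lemma card_mvars_le:
  assumes "computes C p"
  shows "finite (mvars p)" "card (mvars p) \<le> length C"
proof -
  have wf: "wf_gates C" and "C \<noteq> []" and p: "p = last (circuit_values C)"
    using assms by (auto simp: computes_def is_circuit_def wf_gates_def)
  then have "circuit_values C \<noteq> []"
    by (metis length_0_conv length_circuit_values)
  then have sub: "mvars p \<subseteq> input_vars C"
    using mvars_circuit_values[OF wf] p by simp
  have "Var ` input_vars C \<subseteq> set C"
    by (auto simp: input_vars_def)
  then have "card (Var ` input_vars C :: ('a, 'b) gate set) \<le> length C"
    by (meson List.finite_set card_length card_mono le_trans)
  moreover have "finite (input_vars C)"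
    using finite_subset[OF \<open>Var ` input_vars C \<subseteq> set C\<close>]
    by (simp add: finite_image_iff inj_on_def)
  moreover have "card (Var ` input_vars C :: ('a, 'b) gate set) = card (input_vars C)"
    by (rule card_image) (simp add: inj_on_def)
  ultimately show "finite (mvars p)" "card (mvars p) \<le> length C"
    using sub by (auto intro: finite_subset dest: card_mono)
qed

text \<open>Expansions start from stacks with a single entry, so the components of \<open>f\<close>
  have to be members of the family instead of just lying in its spans; adjoining them costs one more
  member per degree.\<close>

lemma computes_quad_family:
  assumes "computes C f"
  shows "\<exists>B. quad_family V (length C * (length C * (D + 1) + 1) + 1) B \<and>
    (\<forall>d\<in>{1..D}. hcomp V d f \<in> B d)"
proof -
  have wf: "wf_gates C" and "C \<noteq> []" and f: "f = last (circuit_values C)"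
    using assms by (auto simp: computes_def is_circuit_def wf_gates_def)
  then have "circuit_values C \<noteq> []"
    by (metis length_0_conv length_circuit_values)
  then have "f \<in> set (circuit_values C)"
    using f by simp
  then obtain B where B: "quad_family V (length C * (length C * (D + 1) + 1)) B" "spanned V D B f"
    using generable_circuit[OF wf, of V D] unfolding generable_def by blast
  define b where "b d = (if 1 \<le> d \<and> d \<le> D then hcomp V d f else 0)" for d
  have "quad_family V (length C * (length C * (D + 1) + 1) + 1) (\<lambda>d. insert (b d) (B d))"
  proof (rule quad_family_insert[OF B(1)])
    show "homog V d (b d)" for d
      by (simp add: b_def homog_hcomp)
    show "b d \<in> mp.span (products B d)" if "2 \<le> d" for d
    proof -
      \<comment> \<open>Members of \<open>B d\<close> are combinations of products, so combinations
        of members are too, and the adjoined component decomposes like the others.\<close>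
      have "mp.span (B d) \<subseteq> mp.span (products B d)"
        using B(1) that mp.span_mono[of "B d" "mp.span (products B d)"]
        by (auto simp: quad_family_def mp.span_span)
      then show ?thesis
        using B(2) by (auto simp: b_def spanned_def mp.span_zero)
    qed
  qed
  moreover have "hcomp V d f \<in> insert (b d) (B d)" if "d \<in> {1..D}" for d
    using that by (simp add: b_def)
  ultimately show ?thesis
    by blast
qed

section \<open>Products of stacks\<close>

text \<open>The elements of \<open>stacks B d j D\<close> are the products of the entries of a stack of height \<open>j\<close> and
  total degree \<open>D\<close>, where the entry at height \<open>i\<close>, counted from \<open>0\<close> at the bottom, has degree at most
  \<open>d / 2 ^ i\<close>; a stack is identified with the product of its entries.\<close>

fun stacks :: "(nat \<Rightarrow> ('v, 'k::field) mpoly set) \<Rightarrow> nat \<Rightarrow> nat \<Rightarrow> nat \<Rightarrow> ('v, 'k) mpoly set" where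
  "stacks B d 0 D = (if D = 0 then {1} else {})"
| "stacks B d (Suc j) D =
     (\<Union>e\<in>{e\<in>{1..d}. e \<le> D \<and> e * 2 ^ j \<le> d}. (\<lambda>(b, r). b * r) ` (B e \<times> stacks B d j (D - e)))"

definition states :: "(nat \<Rightarrow> ('v, 'k::field) mpoly set) \<Rightarrow> nat \<Rightarrow> nat \<Rightarrow> ('v, 'k) mpoly set" where
  "states B d D = (\<Union>j. stacks B d j D)"

text \<open>Each of the \<open>j\<close> entries is fixed by its degree, in at most \<open>d\<close>
  ways, and a member of \<open>B e\<close>, in at most \<open>S\<close> ways; stacks with equal
  product are counted once.\<close>

lemma stacks_finite_card:
  assumes "quad_family V S B"
  shows "finite (stacks B d j D) \<and> card (stacks B d j D) \<le> (d * S) ^ j"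
proof (induction j arbitrary: D)
  case (Suc j)
  let ?I = "{e\<in>{1..d}. e \<le> D \<and> e * 2 ^ j \<le> d}"
  let ?X = "\<lambda>e. (\<lambda>(b, r). b * r) ` (B e \<times> stacks B d j (D - e))"
  have B: "finite (B e)" "card (B e) \<le> S" for e
    using assms by (auto simp: quad_family_def)
  have X: "card (?X e) \<le> S * (d * S) ^ j" for e
  proof -
    have "card (?X e) \<le> card (B e \<times> stacks B d j (D - e))"
      by (rule card_image_le) (use B Suc in auto)
    also have "\<dots> \<le> S * (d * S) ^ j"
      using B Suc by (auto simp: card_cartesian_product intro!: mult_le_mono)
    finally show ?thesis .
  qed
  have "card (\<Union>e\<in>?I. ?X e) \<le> (\<Sum>e\<in>?I. card (?X e))"
    by (rule card_UN_le) simp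
  also have "\<dots> \<le> card ?I * (S * (d * S) ^ j)"
    using sum_bounded_above[of ?I "\<lambda>e. card (?X e)"] X by simp
  also have "\<dots> \<le> d * (S * (d * S) ^ j)"
    by (intro mult_le_mono1) (use card_mono[of "{1..d}" ?I] in fastforce)
  finally show ?case
    using B Suc by (auto simp: mult.assoc)
qed simp

lemma stacks_homog:
  assumes "quad_family V S B" "q \<in> stacks B d j D"
  shows "homog V D q"
  using assms(2)
proof (induction j arbitrary: D q)
  case (Suc j)
  then obtain e b r where "e \<le> D" "b \<in> B e" "r \<in> stacks B d j (D - e)" "q = b * r"
    by auto
  then show ?case
    using Suc.IH[of r "D - e"] assms(1) homog_mult[of V e b "D - e" r] by (auto simp: quad_family_def)
qed (auto split: if_splits)

lemma sum_powers_le: "(\<Sum>i\<le>n. x ^ i) \<le> (x + 1 :: nat) ^ n"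
proof (induction n)
  case (Suc n)
  have "x ^ n \<le> (x + 1) ^ n"
    by (intro power_mono) auto
  then show ?case
    using Suc by (simp add: add_mono)
qed simp

text \<open>A stack of more than \<open>L\<close> entries would contain an entry of degree at least
  1 at some height \<open>i \<ge> L\<close>, against \<open>2 ^ i > d\<close>.\<close>

lemma states_eq:
  assumes "d < 2 ^ L"
  shows "states B d D = (\<Union>j\<le>L. stacks B d j D)"
proof -
  have "stacks B d j D = {}" if j: "j > L" for j
  proof -
    obtain i where i: "j = Suc i" "L \<le> i"
      using j by (cases j) auto
    then have "d < 2 ^ i"
      using assms by (meson less_le_trans one_le_numeral power_increasing)
    then have "\<not> e * 2 ^ i \<le> d" if "1 \<le> e" for e
      using that mult_le_mono1[of 1 e "2 ^ i"] by linarith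
    then show ?thesis
      by (auto simp: i)
  qed
  then show ?thesis
    unfolding states_def by (force simp: not_less[symmetric])
qed

lemma states_finite_card:
  assumes "quad_family V S B" "d < 2 ^ L"
  shows "finite (states B d D)" "card (states B d D) \<le> (d * S + 1) ^ L"
proof -
  note st = stacks_finite_card[OF assms(1)]
  show "finite (states B d D)"
    using st by (simp add: states_eq[OF assms(2)])
  have "card (states B d D) \<le> (\<Sum>j\<le>L. card (stacks B d j D))"
    unfolding states_eq[OF assms(2)] by (rule card_UN_le) simp
  also have "\<dots> \<le> (\<Sum>j\<le>L. (d * S) ^ j)"
    using st by (intro sum_mono) blast
  also have "\<dots> \<le> (d * S + 1) ^ L"
    by (rule sum_powers_le)
  finally show "card (states B d D) \<le> (d * S + 1) ^ L" .
qed

lemma states_homog: "quad_family V S B \<Longrightarrow> q \<in> states B d D \<Longrightarrow> homog V D q"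
  unfolding states_def by (auto intro: stacks_homog)

text \<open>Entries have positive degree, so degree 0 leaves only the empty stack: the final state,
  and later the source of padding factors.\<close>

lemma states_0: "states B d 0 = {1}"
proof -
  have "stacks B d j 0 = (if j = 0 then {1} else {})" for j
    by (cases j) auto
  then show ?thesis
    by (auto simp: states_def)
qed

text \<open>With \<open>Q\<close> a set of states, \<open>c q\<close> plays the role of an entry of
  the transition matrix of the branching program: the sum, over the runs of \<open>t\<close> steps
  ending in \<open>q\<close>, of the products of the emitted linear forms. Only its degree is
  recorded.\<close>

definition hspan :: "'v set \<Rightarrow> nat \<Rightarrow> ('v, 'k::field) mpoly set \<Rightarrow> ('v, 'k) mpoly set" where
  "hspan V t Q = {(\<Sum>q\<in>Q. c q * q) | c. \<forall>q. homog V t (c q)}"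

lemma hspanI: "(\<And>q. homog V t (c q)) \<Longrightarrow> (\<Sum>q\<in>Q. c q * q) \<in> hspan V t Q"
  unfolding hspan_def by blast

lemma hspan_zero: "0 \<in> hspan V t Q"
  unfolding hspan_def by (rule CollectI, rule exI[of _ "\<lambda>_. 0"]) simp

lemma hspan_add: "x \<in> hspan V t Q \<Longrightarrow> y \<in> hspan V t Q \<Longrightarrow> x + y \<in> hspan V t Q"
proof -
  assume "x \<in> hspan V t Q" "y \<in> hspan V t Q"
  then obtain c c' where "\<forall>q. homog V t (c q)" "x = (\<Sum>q\<in>Q. c q * q)"
    "\<forall>q. homog V t (c' q)" "y = (\<Sum>q\<in>Q. c' q * q)"
    unfolding hspan_def by blast
  then show ?thesis
    using hspanI[of V t "\<lambda>q. c q + c' q" Q] by (simp add: distrib_right sum.distrib homog_add)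
qed

lemma hspan_sum: "(\<And>i. i \<in> I \<Longrightarrow> g i \<in> hspan V t Q) \<Longrightarrow> sum g I \<in> hspan V t Q"
  by (induction I rule: infinite_finite_induct) (simp_all add: hspan_zero hspan_add)

lemma hspan_mult:
  assumes "homog V s a" "x \<in> hspan V t Q"
  shows "a * x \<in> hspan V (s + t) Q"
proof -
  obtain c where "\<forall>q. homog V t (c q)" "x = (\<Sum>q\<in>Q. c q * q)"
    using assms unfolding hspan_def by blast
  then show ?thesis
    using hspanI[of V "s + t" "\<lambda>q. a * c q" Q] assms(1)
    by (simp add: sum_distrib_left mult.assoc homog_mult)
qed

lemma hspan_base:
  assumes "finite Q" "q \<in> Q"
  shows "q \<in> hspan V 0 Q"
proof -
  have "q = (\<Sum>q'\<in>Q. (if q' = q then 1 else 0) * q')"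
    using assms by (simp add: if_distrib[of "\<lambda>x. x * _"] sum.delta cong: if_cong)
  then show ?thesis
    using hspanI[of V 0 "\<lambda>q'. if q' = q then 1 else 0" Q] by simp
qed

text \<open>Rewriting the top of the stack: the heavier factor of a product is pushed back and the lighter
  one, whose degree is at most half, becomes the new top; a linear top is emitted.\<close>

lemma push_in_hspan:
  assumes B: "quad_family V S B"
    and "r \<in> stacks B d j D" "b \<in> B e" "1 \<le> e" "e * 2 ^ j \<le> d"
  shows "b * r \<in> hspan V 1 (states B d (D + e - 1))"
  using assms(2-)
proof (induction e arbitrary: b r j D rule: less_induct)
  case (less e)
  obtain L where "d < 2 ^ L"
    using less_exp by blast
  note fin = states_finite_card(1)[OF B this]
  show ?case
  proof (cases "e = 1")
    case True
    have "r \<in> states B d D"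
      using less by (auto simp: states_def)
    then have "r \<in> hspan V 0 (states B d D)"
      by (intro hspan_base fin)
    moreover have "homog V 1 b"
      using B less True by (auto simp: quad_family_def)
    ultimately show ?thesis
      using hspan_mult[of V 1 b r 0] True by simp
  next
    case False
    then have "e \<ge> 2"
      using less by simp
    have push: "x * y * r \<in> hspan V 1 (states B d (D + e - 1))"
      if xy: "x \<in> B i" "y \<in> B (e - i)" "0 < i" "i < e" "e - i \<le> i" for x y i
    proof -
      have "i * 2 ^ j \<le> d"
        using mult_le_mono1[of i e "2 ^ j"] less.prems(4) \<open>i < e\<close> by linarith
      moreover have "i * 1 \<le> i * 2 ^ j"
        by (rule mult_le_mono2) simp
      ultimately have "i \<le> d"
        by linarith
      then have "x * r \<in> stacks B d (Suc j) (D + i)"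
        using xy less.prems \<open>i * 2 ^ j \<le> d\<close>
        by (auto intro!: exI[of _ i] image_eqI[of _ _ "(x, r)"])
      \<comment> \<open>The lighter factor has degree at most \<open>e / 2\<close>, which pays for
        the weight \<open>2 ^ Suc j\<close> of the next height.\<close>
      moreover have "(e - i) * 2 ^ Suc j \<le> d"
      proof -
        have "(e - i) * 2 ^ Suc j = (2 * (e - i)) * 2 ^ j"
          by simp
        also have "\<dots> \<le> e * 2 ^ j"
          by (rule mult_le_mono1) (use xy in simp)
        finally show ?thesis
          using less.prems(4) by (rule order_trans)
      qed
      ultimately have "y * (x * r) \<in> hspan V 1 (states B d (D + i + (e - i) - 1))"
        using xy by (intro less.IH[where j = "Suc j"]) (simp_all del: stacks.simps power_Suc)
      then show ?thesis
        using xy by (simp add: mult_ac)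
    qed
    have prod: "p * r \<in> hspan V 1 (states B d (D + e - 1))" if p: "p \<in> products B e" for p
    proof -
      obtain x y i where xy: "p = x * y" "x \<in> B i" "y \<in> B (e - i)" "0 < i" "i < e"
        using p by (auto simp: products_def)
      show ?thesis
      proof (cases "e - i \<le> i")
        case True
        then show ?thesis
          using push xy by blast
      next
        case False
        then show ?thesis
          using push[of y "e - i" x] xy by (simp add: mult_ac)
      qed
    qed
    have "b \<in> mp.span (products B e)"
      using B \<open>e \<ge> 2\<close> less.prems by (auto simp: quad_family_def)
    then show ?thesis
    proof (induction rule: mp.span_induct_alt)
      case base
      then show ?case by (simp add: hspan_zero)
    next
      case (step c x y)
      have "mconst c * (x * r) + y * r \<in> hspan V 1 (states B d (D + e - 1))"
        using hspan_mult[OF homog_mconst prod[OF step(1)], of c] step(2) by (simp add: hspan_add)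
      then show ?case
        by (simp add: algebra_simps)
    qed
  qed
qed

text \<open>Iterates the single step: coefficients multiply along a run, and every step emits
  exactly one linear form, so after \<open>t\<close> steps they have degree \<open>t\<close>. A step
  needs a non-empty stack, which \<open>t \<le> D\<close> guarantees.\<close>

lemma states_step:
  assumes "quad_family V S B" "q \<in> states B d D" "t \<le> D"
  shows "q \<in> hspan V t (states B d (D - t))"
  using assms(3)
proof (induction t)
  case 0
  obtain L where "d < 2 ^ L"
    using less_exp by blast
  then show ?case
    using states_finite_card[OF assms(1)] assms(2) by (simp add: hspan_base)
next
  case (Suc t)
  have one: "q' \<in> hspan V 1 (states B d (D' - 1))" if q': "q' \<in> states B d D'" "D' \<ge> 1" for q' D'
  proof -
    obtain j where "q' \<in> stacks B d j D'"
      using q' by (auto simp: states_def)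
    then obtain i where "q' \<in> stacks B d (Suc i) D'"
      using q' by (cases j) (auto split: if_splits)
    then obtain e b r where "e \<le> D'" "1 \<le> e" "e * 2 ^ i \<le> d" "b \<in> B e" "r \<in> stacks B d i (D' - e)" "q' = b * r"
      by auto
    then show ?thesis
      using push_in_hspan[OF assms(1), of r d i "D' - e" b e] by simp
  qed
  obtain c where c: "\<forall>q. homog V t (c q)" "q = (\<Sum>q'\<in>states B d (D - t). c q' * q')"
    using Suc by (auto simp: hspan_def)
  have "c q' * q' \<in> hspan V (Suc t) (states B d (D - Suc t))" if "q' \<in> states B d (D - t)" for q'
    using hspan_mult[OF _ one[OF that], of t "c q'"] c Suc.prems by simp
  then show ?case
    unfolding c(2) by (rule hspan_sum)
qed

section \<open>Expansion into products of low-degree polynomials\<close>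

text \<open>The number of factors is exact so that the pieces of a cut expansion compose; shorter
  products get padded by 1. A list of products keeps repetitions.\<close>

definition sum_of_products :: "'a::comm_ring_1 set \<Rightarrow> nat \<Rightarrow> nat \<Rightarrow> 'a \<Rightarrow> bool" where
  "sum_of_products P k M f \<longleftrightarrow>
     (\<exists>J. length J \<le> M \<and> (\<forall>x\<in>set J. length x = k \<and> set x \<subseteq> P) \<and> f = (\<Sum>x\<leftarrow>J. prod_list x))"

lemma sum_of_products_mono: "sum_of_products P k M f \<Longrightarrow> M \<le> M' \<Longrightarrow> sum_of_products P k M' f"
  unfolding sum_of_products_def by (blast intro: le_trans)

lemma sum_of_products_prod_list:
  "length x = k \<Longrightarrow> set x \<subseteq> P \<Longrightarrow> sum_of_products P k 1 (prod_list x)"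
  unfolding sum_of_products_def by (rule exI[of _ "[x]"]) simp

lemma sum_of_products_zero: "sum_of_products P k 0 0"
  unfolding sum_of_products_def by (rule exI[of _ "[]"]) simp

lemma sum_of_products_add:
  assumes "sum_of_products P k M f" "sum_of_products P k M' g"
  shows "sum_of_products P k (M + M') (f + g)"
proof -
  obtain J J' where "length J \<le> M" "\<forall>x\<in>set J. length x = k \<and> set x \<subseteq> P" "f = (\<Sum>x\<leftarrow>J. prod_list x)"
    "length J' \<le> M'" "\<forall>x\<in>set J'. length x = k \<and> set x \<subseteq> P" "g = (\<Sum>x\<leftarrow>J'. prod_list x)"
    using assms unfolding sum_of_products_def by blast
  then show ?thesis
    unfolding sum_of_products_def by (intro exI[of _ "J @ J'"]) auto
qed

lemma sum_of_products_sum: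
  assumes "finite A" "\<And>a. a \<in> A \<Longrightarrow> sum_of_products P k M (g a)"
  shows "sum_of_products P k (card A * M) (sum g A)"
  using assms
proof (induction A rule: finite_induct)
  case (insert a A)
  then show ?case
    using sum_of_products_add[of P k M "g a" "card A * M" "sum g A"] by simp
qed (simp add: sum_of_products_zero)

lemma sum_of_products_mult:
  assumes "a \<in> P" "sum_of_products P k M f"
  shows "sum_of_products P (Suc k) M (a * f)"
proof -
  obtain J where "length J \<le> M" "\<forall>x\<in>set J. length x = k \<and> set x \<subseteq> P" "f = (\<Sum>x\<leftarrow>J. prod_list x)"
    using assms unfolding sum_of_products_def by blast
  then show ?thesis
    unfolding sum_of_products_def using assms(1)
    by (intro exI[of _ "map ((#) a) J"]) (auto simp: o_def sum_list_const_mult)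
qed

lemma homog_total_degree: "homog V d p \<Longrightarrow> d \<le> t \<Longrightarrow> total_degree p \<le> t"
  unfolding total_degree_def homog_def by auto

lemma homog_mvars: "homog V d p \<Longrightarrow> mvars p \<subseteq> V"
  unfolding mvars_def homog_def by auto

text \<open>There are \<open>k\<close> cuts, each after \<open>t\<close> emitted linear forms, and
  at each cut one of at most \<open>N\<close> states is chosen: \<open>N ^ k\<close> products for
  each of the \<open>D\<close> components of positive degree, and one for the constant term. The
  summands in the bound on \<open>card P\<close> count the constant term and 1, then the states of
  degree at most \<open>t\<close> (last segments), then the coefficients between states whose
  degrees differ by \<open>t\<close>.\<close>

lemma computes_imp_sum_of_products:
  fixes f :: "('v, 'k::field) mpoly"
  assumes C: "computes C f"
    and D: "total_degree f \<le> D" "D \<le> Suc k * t" "D < 2 ^ L"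
    and N: "N = (D * (length C * (length C * (D + 1) + 1) + 1) + 1) ^ L"
  shows "\<exists>P. finite P \<and> card P \<le> 2 + (t + 1) * N + (D + 1) * (N * N) \<and>
    (\<forall>p\<in>P. total_degree p \<le> t \<and> mvars p \<subseteq> mvars f) \<and>
    sum_of_products P (Suc k) (1 + D * N ^ k) f"
proof -
  define V where "V = mvars f"
  obtain B where B: "quad_family V (length C * (length C * (D + 1) + 1) + 1) B"
    and fB: "\<And>d. d \<in> {1..D} \<Longrightarrow> hcomp V d f \<in> B d"
    using computes_quad_family[OF C, of V D] by blast
  define Q where "Q = states B D"
  have Q: "finite (Q d)" "card (Q d) \<le> N" for d
    using states_finite_card[OF B D(3)] by (auto simp: Q_def N)
  have homog_Q: "homog V d q" if "q \<in> Q d" for d q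
    using states_homog[OF B] that by (auto simp: Q_def)
  \<comment> \<open>One expansion is fixed for each state and degree, so the same segment
    polynomials recur in all products; this keeps \<open>P\<close> small.\<close>
  define c where "c d q = (SOME c. (\<forall>q'. homog V t (c q')) \<and> q = (\<Sum>q'\<in>Q (d - t). c q' * q'))" for d q
  have c: "(\<forall>q'. homog V t (c d q q')) \<and> q = (\<Sum>q'\<in>Q (d - t). c d q q' * q')"
    if "q \<in> Q d" "t \<le> d" for d q
  proof -
    have "\<exists>c. (\<forall>q'. homog V t (c q')) \<and> q = (\<Sum>q'\<in>Q (d - t). c q' * q')"
      using states_step[OF B, of q D d t] that unfolding Q_def hspan_def by blast
    from someI_ex[OF this] show ?thesis
      unfolding c_def .
  qed
  define c0 where "c0 = Poly_Mapping.lookup f 0"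
  define P1 where "P1 = (\<Union>d\<le>t. Q d)"
  define P2 where "P2 = (\<Union>d\<in>{t..D}. (\<lambda>(q, q'). c d q q') ` (Q d \<times> Q (d - t)))"
  define P where "P = {mconst c0, 1} \<union> (P1 \<union> P2)"
  have P1: "finite P1" "card P1 \<le> (t + 1) * N"
  proof -
    show "finite P1" using Q by (simp add: P1_def)
    have "card P1 \<le> (\<Sum>d\<le>t. card (Q d))"
      unfolding P1_def by (rule card_UN_le) simp
    also have "\<dots> \<le> (t + 1) * N"
      using sum_bounded_above[of "{..t}" "\<lambda>d. card (Q d)" N] Q by simp
    finally show "card P1 \<le> (t + 1) * N" .
  qed
  have P2: "finite P2" "card P2 \<le> (D + 1) * (N * N)"
  proof -
    show "finite P2" using Q by (simp add: P2_def)
    have le: "card ((\<lambda>(q, q'). c d q q') ` (Q d \<times> Q (d - t))) \<le> N * N" for d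
    proof -
      have "card ((\<lambda>(q, q'). c d q q') ` (Q d \<times> Q (d - t))) \<le> card (Q d \<times> Q (d - t))"
        using Q by (intro card_image_le) auto
      also have "\<dots> \<le> N * N"
        using Q by (auto simp: card_cartesian_product intro!: mult_le_mono)
      finally show ?thesis .
    qed
    have "card P2 \<le> (\<Sum>d\<in>{t..D}. card ((\<lambda>(q, q'). c d q q') ` (Q d \<times> Q (d - t))))"
      unfolding P2_def by (rule card_UN_le) simp
    also have "\<dots> \<le> card {t..D} * (N * N)"
      using sum_bounded_above[of "{t..D}" "\<lambda>d. card ((\<lambda>(q, q'). c d q q') ` (Q d \<times> Q (d - t)))" "N * N"] le
      by simp
    also have "\<dots> \<le> (D + 1) * (N * N)"
      by (rule mult_le_mono1) auto
    finally show "card P2 \<le> (D + 1) * (N * N)" .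
  qed
  have "finite P"
    using P1 P2 by (simp add: P_def)
  have "card P \<le> card {mconst c0, 1 :: ('v, 'k) mpoly} + (card P1 + card P2)"
    unfolding P_def by (meson add_left_mono card_Un_le le_trans)
  moreover have "card {mconst c0, 1 :: ('v, 'k) mpoly} \<le> 2"
    by (simp add: card_insert_if)
  ultimately have card_P: "card P \<le> 2 + (t + 1) * N + (D + 1) * (N * N)"
    using P1 P2 by linarith
  have "\<exists>d\<le>t. homog V d p" if "p \<in> P" for p
    using that unfolding P_def
  proof (elim UnE)
    assume "p \<in> {mconst c0, 1}"
    then show ?thesis by (intro exI[of _ 0]) auto
  next
    assume "p \<in> P1"
    then show ?thesis using homog_Q by (auto simp: P1_def)
  next
    assume "p \<in> P2"
    then show ?thesis using c by (auto simp: P2_def)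
  qed
  then have low: "total_degree p \<le> t \<and> mvars p \<subseteq> V" if "p \<in> P" for p
    using that by (blast dest: homog_total_degree homog_mvars)
  have "1 \<in> Q 0"
    by (simp add: Q_def states_0)
  then have "N \<ge> 1"
    using card_mono[of "Q 0" "{1}"] Q[of 0] by simp
  have expand: "sum_of_products P (Suc k) (N ^ k) q" if "q \<in> Q d" "d \<le> D" "d \<le> Suc k * t" for d q k
    using that
  proof (induction k arbitrary: d q)
    case 0
    then have "q \<in> P" by (auto simp: P_def P1_def)
    then show ?case
      using sum_of_products_prod_list[of "[q]"] by simp
  next
    case (Suc k)
    show ?case
    proof (cases "d \<le> t")
      case True
      then have "q \<in> P"
        using Suc.prems by (auto simp: P_def P1_def)
      \<comment> \<open>A state of degree at most \<open>t\<close> is a single factor; the rest of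
        the product is an expansion of 1, the state of degree 0.\<close>
      then have "sum_of_products P (Suc (Suc k)) (N ^ k) (q * 1)"
        by (rule sum_of_products_mult) (use Suc.IH \<open>1 \<in> Q 0\<close> in auto)
      then show ?thesis
        using \<open>N \<ge> 1\<close> by (auto intro: sum_of_products_mono)
    next
      case False
      then have "t \<le> d" by simp
      \<comment> \<open>One segment of \<open>t\<close> steps is cut off; a state of degree
        \<open>d - t\<close> remains for the other factors.\<close>
      have "sum_of_products P (Suc (Suc k)) (N ^ k) (c d q q' * q')" if q': "q' \<in> Q (d - t)" for q'
      proof (rule sum_of_products_mult)
        show "c d q q' \<in> P"
          using Suc.prems \<open>t \<le> d\<close> q' by (force simp: P_def P2_def)
        show "sum_of_products P (Suc k) (N ^ k) q'"
          by (rule Suc.IH[OF q']) (use Suc.prems in auto)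
      qed
      then have "sum_of_products P (Suc (Suc k)) (card (Q (d - t)) * N ^ k) q"
        using sum_of_products_sum[OF Q(1), of "d - t" P _ _ "\<lambda>q'. c d q q' * q'"]
          c[OF Suc.prems(1) \<open>t \<le> d\<close>] by simp
      then show ?thesis
        by (rule sum_of_products_mono) (use Q in simp)
    qed
  qed
  have "sum_of_products P (Suc k) 1 (mconst c0)"
    using sum_of_products_prod_list[of "mconst c0 # replicate k 1" "Suc k" P]
    by (simp add: P_def set_replicate_conv_if)
  moreover have "sum_of_products P (Suc k) (D * N ^ k) (\<Sum>d\<in>{1..D}. hcomp V d f)"
  proof -
    have "sum_of_products P (Suc k) (N ^ k) (hcomp V d f)" if d: "d \<in> {1..D}" for d
    proof (rule expand)
      \<comment> \<open>The component as a stack with one entry: the bottom height allows any degree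
        up to \<open>D\<close>.\<close>
      have "hcomp V d f \<in> stacks B D (Suc 0) d"
        using d fB[OF d] by (auto intro!: exI[of _ d] image_eqI[of _ _ "(hcomp V d f, 1)"])
      then show "hcomp V d f \<in> Q d"
        unfolding Q_def states_def by blast
    qed (use d D in auto)
    then show ?thesis
      using sum_of_products_sum[of "{1..D}" P "Suc k" "N ^ k" "\<lambda>d. hcomp V d f"] by simp
  qed
  ultimately have "sum_of_products P (Suc k) (1 + D * N ^ k) (mconst c0 + (\<Sum>d\<in>{1..D}. hcomp V d f))"
    by (rule sum_of_products_add)
  also have "mconst c0 + (\<Sum>d\<in>{1..D}. hcomp V d f) = f"
  proof -
    have "{..D} = insert 0 {1..D}" by auto
    then show ?thesis
      using sum_hcomp[OF D(1), of V] by (simp add: V_def c0_def hcomp_0_eq)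
  qed
  finally show ?thesis
    using \<open>finite P\<close> card_P low unfolding V_def by blast
qed

section \<open>Depth-four circuits\<close>

fun input_value :: "('v, 'k::field) gate \<Rightarrow> ('v, 'k) mpoly" where
  "input_value (Var x) = mvar x"
| "input_value (Const c) = mconst c"
| "input_value _ = 0"

text \<open>A sum of products of inputs given by labels alone, independent of positions, so that a
  block with this value can be laid out anywhere, and several times in a formula.\<close>

definition sigma_pi_value :: "('v, 'k::field) gate list list \<Rightarrow> ('v, 'k) mpoly" where
  "sigma_pi_value T = (\<Sum>gs\<leftarrow>T. \<Prod>g\<leftarrow>gs. input_value g)"

text \<open>The lists are non-empty because \<open>is_circuit\<close> requires every addition and
  multiplication gate to have an argument.\<close>

definition sigma_pi :: "'v set \<Rightarrow> nat \<Rightarrow> nat \<Rightarrow> ('v, 'k) gate list list \<Rightarrow> bool" where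
  "sigma_pi V t M T \<longleftrightarrow> T \<noteq> [] \<and> length T \<le> M \<and>
     (\<forall>gs\<in>set T. gs \<noteq> [] \<and> length gs \<le> t \<and> (\<forall>g\<in>set gs. is_input g \<and> (\<forall>x. g = Var x \<longrightarrow> x \<in> V)))"

lemma monom_as_list:
  "\<exists>xs. length xs = monom_degree m \<and> set xs \<subseteq> Poly_Mapping.keys m \<and>
     (\<Prod>x\<leftarrow>xs. mvar x) = (Poly_Mapping.single m 1 :: ('v, 'k::field) mpoly)"
proof (induction "monom_degree m" arbitrary: m)
  case 0
  then have "m = 0" by simp
  then show ?case by simp
next
  case (Suc n)
  then have "m \<noteq> 0" by auto
  then obtain x where x: "x \<in> Poly_Mapping.keys m"
    using poly_mapping_eqI[of m 0] by (auto simp: in_keys_iff)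
  define m' where "m' = m - Poly_Mapping.single x 1"
  have m: "m = Poly_Mapping.single x 1 + m'"
    by (rule poly_mapping_eqI)
      (use x in \<open>auto simp: m'_def lookup_add lookup_minus lookup_single in_keys_iff when_def\<close>)
  then have "n = monom_degree m'"
    using Suc(2) monom_degree_add[of "Poly_Mapping.single x 1" m'] by simp
  then obtain xs where xs: "length xs = n" "set xs \<subseteq> Poly_Mapping.keys m'"
    "(\<Prod>x\<leftarrow>xs. mvar x) = (Poly_Mapping.single m' 1 :: ('v, 'k) mpoly)"
    using Suc(1) by blast
  have "Poly_Mapping.keys m' \<subseteq> Poly_Mapping.keys m"
    using keys_monom_add[of "Poly_Mapping.single x 1" m'] m by auto
  moreover have "mvar x * (\<Prod>x\<leftarrow>xs. mvar x) = (Poly_Mapping.single m 1 :: ('v, 'k) mpoly)"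
    unfolding xs(3) by (simp add: mvar_def mult_single m)
  ultimately show ?case
    using xs x Suc(2) by (intro exI[of _ "x # xs"]) auto
qed

text \<open>Each monomial of \<open>p\<close> is the product of a word over \<open>V\<close> of
  length at most \<open>t\<close>, and there are at most \<open>(card V + 1) ^ t\<close> such
  words.\<close>

lemma card_keys_le:
  fixes p :: "('v, 'k::field) mpoly"
  assumes "total_degree p \<le> t" "mvars p \<subseteq> V" "finite V"
  shows "card (Poly_Mapping.keys p) \<le> (card V + 1) ^ t"
proof -
  let ?X = "{xs. set xs \<subseteq> V \<and> length xs \<le> t}"
  let ?single = "\<lambda>m. Poly_Mapping.single m 1 :: ('v, 'k) mpoly"
  have "?single ` Poly_Mapping.keys p \<subseteq> (\<lambda>xs. \<Prod>x\<leftarrow>xs. mvar x) ` ?X"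
  proof safe
    fix m assume m: "m \<in> Poly_Mapping.keys p"
    obtain xs where xs: "length xs = monom_degree m" "set xs \<subseteq> Poly_Mapping.keys m"
      "(\<Prod>x\<leftarrow>xs. mvar x) = ?single m"
      using monom_as_list[of m, where 'k = 'k] by blast
    moreover have "set xs \<subseteq> V"
      using xs m assms(2) by (auto simp: mvars_def)
    moreover have "length xs \<le> t"
      using xs monom_degree_le_total_degree[OF m] assms(1) by simp
    ultimately show "?single m \<in> (\<lambda>xs. \<Prod>x\<leftarrow>xs. mvar x) ` ?X"
      by (intro image_eqI[of _ _ xs]) auto
  qed
  then have "card (?single ` Poly_Mapping.keys p) \<le> card ?X"
    by (rule surj_card_le[OF finite_lists_length_le[OF assms(3)]])
  also have "card ?X = (\<Sum>i\<le>t. card V ^ i)"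
    by (rule card_lists_length_le[OF assms(3)])
  also have "\<dots> \<le> (card V + 1) ^ t"
    by (rule sum_powers_le)
  also have "card (?single ` Poly_Mapping.keys p) = card (Poly_Mapping.keys p)"
  proof (rule card_image, rule inj_onI)
    fix m m' assume "?single m = ?single m'"
    then have "Poly_Mapping.keys (?single m) = Poly_Mapping.keys (?single m')"
      by simp
    then show "m = m'" by simp
  qed
  finally show ?thesis .
qed

lemma sigma_pi_exists:
  fixes p :: "('v, 'k::field) mpoly"
  assumes "total_degree p \<le> t" "mvars p \<subseteq> V" "finite V"
  shows "\<exists>T. sigma_pi V (t + 1) ((card V + 1) ^ t + 1) T \<and> sigma_pi_value T = p"
proof -
  obtain ms where ms: "set ms = Poly_Mapping.keys p" "distinct ms"
    using finite_distinct_list[of "Poly_Mapping.keys p"] by auto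
  have "\<forall>m. \<exists>xs. length xs = monom_degree m \<and> set xs \<subseteq> Poly_Mapping.keys m \<and>
     (\<Prod>x\<leftarrow>xs. mvar x) = (Poly_Mapping.single m 1 :: ('v, 'k) mpoly)"
    by (intro allI monom_as_list)
  from choice[OF this] obtain w where w: "\<forall>m. length (w m) = monom_degree m \<and>
      set (w m) \<subseteq> Poly_Mapping.keys m \<and>
      (\<Prod>x\<leftarrow>w m. mvar x) = (Poly_Mapping.single m 1 :: ('v, 'k) mpoly)" ..
  \<comment> \<open>The summand 0 keeps the sum non-empty when \<open>p = 0\<close> and accounts for
    the extra 1 in the number of summands; the coefficient accounts for the one in the fan-in
    \<open>t + 1\<close>.\<close>
  let ?T = "[Const 0] # map (\<lambda>m. Const (Poly_Mapping.lookup p m) # map Var (w m)) ms"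
  have "sigma_pi_value ?T = (\<Sum>m\<leftarrow>ms. mconst (Poly_Mapping.lookup p m) * Poly_Mapping.single m 1)"
    using w by (simp add: sigma_pi_value_def o_def)
  also have "\<dots> = (\<Sum>m\<in>Poly_Mapping.keys p. Poly_Mapping.single m (Poly_Mapping.lookup p m))"
    using ms by (simp add: sum_list_distinct_conv_sum_set mconst_def mult_single)
  also have "\<dots> = p"
    by (rule poly_mapping_eqI)
      (auto simp: lookup_sum lookup_single when_def in_keys_iff sum.delta)
  finally have "sigma_pi_value ?T = p" .
  moreover have "length ms \<le> (card V + 1) ^ t"
    using card_keys_le[OF assms] ms distinct_card[of ms] by simp
  moreover have "length (w m) \<le> t" "set (w m) \<subseteq> V" if "m \<in> set ms" for m
    using that ms w[rule_format, of m] monom_degree_le_total_degree[of m p] assms by (auto simp: mvars_def)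
  ultimately show ?thesis
    by (intro exI[of _ ?T]) (auto simp: sigma_pi_def dest: subsetD)
qed

section \<open>Blocks of gates appended to a circuit\<close>

definition gates_ok :: "('v, 'k) circuit \<Rightarrow> bool" where
  "gates_ok C \<longleftrightarrow> wf_gates C \<and> (\<forall>g\<in>set C. \<not> is_input g \<longrightarrow> args g \<noteq> [])"

definition gate_bounded :: "'v set \<Rightarrow> nat \<Rightarrow> ('v, 'k) gate \<Rightarrow> bool" where
  "gate_bounded V t g \<longleftrightarrow> (is_mul g \<longrightarrow> fan_in g \<le> t) \<and> (\<forall>x. g = Var x \<longrightarrow> x \<in> V)"

text \<open>With this multiset of all arguments, the fan-out condition on a formula becomes an equation that
  is additive under appending gates.\<close>

definition used :: "('v, 'k) circuit \<Rightarrow> nat multiset" where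
  "used C = mset (concat (map args C))"

text \<open>Described by labels, a block keeps its description when gates are appended; its value
  and its depth four shape are read off at the end.\<close>

definition product_at :: "('v, 'k) circuit \<Rightarrow> nat \<Rightarrow> ('v, 'k) gate list \<Rightarrow> bool" where
  "product_at C q gs \<longleftrightarrow> q < length C \<and>
     (\<exists>as. C ! q = Mul as \<and> (\<forall>a\<in>set as. a < length C) \<and> map ((!) C) as = gs)"

definition sum_at :: "('v, 'k) circuit \<Rightarrow> nat \<Rightarrow> ('v, 'k) gate list list \<Rightarrow> bool" where
  "sum_at C q T \<longleftrightarrow> q < length C \<and> (\<exists>ps. C ! q = Add ps \<and> list_all2 (product_at C) ps T)"

lemma gates_ok_snoc:
  "gates_ok (C @ [g]) \<longleftrightarrow>
     gates_ok C \<and> (\<forall>j\<in>set (args g). j < length C) \<and> (\<not> is_input g \<longrightarrow> args g \<noteq> [])"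
  by (auto simp: gates_ok_def wf_gates_snoc)

lemma gates_ok_append:
  assumes "gates_ok C"
    and "\<And>g. g \<in> set E \<Longrightarrow> (\<forall>j\<in>set (args g). j < length C) \<and> (\<not> is_input g \<longrightarrow> args g \<noteq> [])"
  shows "gates_ok (C @ E)"
  using assms(2)
proof (induction E rule: rev_induct)
  case (snoc g E)
  then show ?case
    unfolding append_assoc[symmetric] gates_ok_snoc by (auto intro: trans_less_add1)
qed (use assms(1) in simp)

text \<open>Non-emptiness is left out of \<open>gates_ok\<close> because the constructions start
  from the empty list, which \<open>is_circuit\<close> rejects.\<close>

lemma gates_ok_imp_is_circuit: "gates_ok C \<Longrightarrow> C \<noteq> [] \<Longrightarrow> is_circuit C"
  by (auto simp: gates_ok_def is_circuit_def wf_gates_def)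

lemma args_input [simp]: "is_input g \<Longrightarrow> args g = []"
  by (cases g) auto

lemma not_mul_add_input [simp]: "is_input g \<Longrightarrow> \<not> is_mul g" "is_input g \<Longrightarrow> \<not> is_add g"
  by (cases g; simp)+

lemma used_append [simp]: "used (C @ E) = used C + used E"
  by (simp add: used_def)

lemma used_singleton: "used [g] = mset (args g)"
  by (simp add: used_def)

lemma used_inputs: "\<forall>g\<in>set gs. is_input g \<Longrightarrow> used gs = {#}"
  by (induction gs) (auto simp: used_def)

lemma fan_out_eq_count_used: "fan_out C i = count (used C) i"
  by (induction C) (auto simp: fan_out_def used_def count_mset)

lemma num_append [simp]:
  "num_mul (C @ E) = num_mul C + num_mul E" "num_add (C @ E) = num_add C + num_add E"
  by (simp_all add: num_mul_def num_add_def)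

lemma num_inputs:
  assumes "\<forall>g\<in>set gs. is_input g"
  shows "num_mul gs = 0" "num_add gs = 0"
  using assms by (auto simp: num_mul_def num_add_def filter_empty_conv)

lemma product_at_append: "product_at C q gs \<Longrightarrow> product_at (C @ E) q gs"
  unfolding product_at_def by (force simp: nth_append)

lemma sum_at_append: "sum_at C q T \<Longrightarrow> sum_at (C @ E) q T"
  unfolding sum_at_def by (auto simp: nth_append intro: list_all2_mono product_at_append)

text \<open>Every product gets fresh input gates. The multiset equation says that each new gate is
  used exactly once, where the roots \<open>ps\<close>, still open, are counted as used by a gate
  yet to come.\<close>

lemma add_products:
  assumes "gates_ok C"
    and "\<And>gs. gs \<in> set T \<Longrightarrow> gs \<noteq> [] \<and> length gs \<le> t \<and> (\<forall>g\<in>set gs. is_input g \<and> (\<forall>x. g = Var x \<longrightarrow> x \<in> V))"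
  shows "\<exists>E ps. gates_ok (C @ E) \<and> list_all2 (product_at (C @ E)) ps T \<and>
    used E + mset ps = mset [length C..<length C + length E] \<and>
    num_add E = 0 \<and> num_mul E = length T \<and> length E \<le> length T * (t + 1) \<and>
    (\<forall>g\<in>set E. gate_bounded V t g)"
  using assms
proof (induction T arbitrary: C)
  case Nil
  then show ?case
    by (intro exI[of _ "[]"]) (simp add: used_def num_add_def num_mul_def)
next
  case (Cons gs T)
  define n l where "n = length C" and "l = length gs"
  define X where "X = gs @ [Mul [n..<n + l]]"
  have gs: "gs \<noteq> []" "l \<le> t" "\<forall>g\<in>set gs. is_input g" "\<forall>g\<in>set gs. \<forall>x. g = Var x \<longrightarrow> x \<in> V"
    using Cons.prems(2)[of gs] by (auto simp: l_def)
  have "gates_ok (C @ gs)"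
    by (rule gates_ok_append) (use Cons.prems gs in auto)
  then have ok: "gates_ok (C @ X)"
    using gs gates_ok_snoc[of "C @ gs" "Mul [n..<n + l]"] by (auto simp: X_def n_def l_def)
  have "\<exists>E ps. gates_ok ((C @ X) @ E) \<and> list_all2 (product_at ((C @ X) @ E)) ps T \<and>
    used E + mset ps = mset [length (C @ X)..<length (C @ X) + length E] \<and>
    num_add E = 0 \<and> num_mul E = length T \<and> length E \<le> length T * (t + 1) \<and>
    (\<forall>g\<in>set E. gate_bounded V t g)"
    by (rule Cons.IH[OF ok]) (rule Cons.prems(2), simp)
  then obtain E ps where E: "gates_ok ((C @ X) @ E)" "list_all2 (product_at ((C @ X) @ E)) ps T"
    "used E + mset ps = mset [length (C @ X)..<length (C @ X) + length E]"
    "num_add E = 0" "num_mul E = length T" "length E \<le> length T * (t + 1)"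
    "\<forall>g\<in>set E. gate_bounded V t g"
    by blast
  have "map ((!) (C @ X)) [n..<n + l] = gs"
    by (rule nth_equalityI) (auto simp: n_def l_def X_def nth_append)
  then have "product_at (C @ X) (n + l) gs"
    unfolding product_at_def by (auto simp: n_def l_def X_def nth_append)
  then have "product_at ((C @ X) @ E) (n + l) gs"
    by (rule product_at_append)
  then have "list_all2 (product_at (C @ X @ E)) ((n + l) # ps) (gs # T)"
    using E(2) by simp
  moreover have "used (X @ E) + mset ((n + l) # ps) = mset [n..<n + length (X @ E)]"
  proof -
    have "[n..<n + length (X @ E)] = [n..<n + l] @ [n + l] @ [n + l + 1..<n + l + 1 + length E]"
      using upt_add_eq_append[of n "n + l" "1 + length E"] upt_conv_Cons[of "n + l" "n + l + 1 + length E"]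
      by (simp add: X_def l_def add.assoc)
    then have "mset [n..<n + length (X @ E)]
        = mset [n..<n + l] + {#n + l#} + mset [n + l + 1..<n + l + 1 + length E]"
      by simp
    also have "mset [n + l + 1..<n + l + 1 + length E] = used E + mset ps"
      using E(3) by (simp add: X_def n_def l_def add.assoc)
    also have "mset [n..<n + l] = used X"
      using used_inputs[OF gs(3)] by (simp add: X_def used_singleton del: mset_upt)
    finally show ?thesis
      by (simp add: ac_simps)
  qed
  moreover have "num_add (X @ E) = 0" "num_mul (X @ E) = length (gs # T)"
    using E num_inputs[OF gs(3)] by (simp_all add: X_def) (simp_all add: num_add_def num_mul_def)
  moreover have "length (X @ E) \<le> length (gs # T) * (t + 1)"
    using E(6) gs(2) by (simp add: X_def l_def)
  moreover have "\<forall>g\<in>set (X @ E). gate_bounded V t g"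
    using E(7) gs by (auto simp: X_def gate_bounded_def fan_in_def)
  ultimately show ?case
    using E(1) unfolding n_def append_assoc
    by (intro exI[of _ "X @ E"] exI[of _ "(length C + l) # ps"] conjI)
qed

text \<open>The same bookkeeping one level up: the addition gate of a block closes its open
  products, and only the addition gates \<open>qs\<close> remain open.\<close>

lemma add_sums:
  assumes "gates_ok C" "\<And>T. T \<in> set Ts \<Longrightarrow> sigma_pi V t M T"
  shows "\<exists>E qs. gates_ok (C @ E) \<and> list_all2 (sum_at (C @ E)) qs Ts \<and>
    used E + mset qs = mset [length C..<length C + length E] \<and>
    num_add E = length Ts \<and> num_mul E \<le> length Ts * M \<and>
    length E \<le> length Ts * (M * (t + 1) + 1) \<and> (\<forall>g\<in>set E. gate_bounded V t g)"
  using assms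
proof (induction Ts arbitrary: C)
  case Nil
  then show ?case
    by (intro exI[of _ "[]"]) (simp add: used_def num_add_def num_mul_def)
next
  case (Cons T Ts)
  have T: "sigma_pi V t M T"
    using Cons.prems by simp
  then obtain E1 ps where E1: "gates_ok (C @ E1)" "list_all2 (product_at (C @ E1)) ps T"
    "used E1 + mset ps = mset [length C..<length C + length E1]"
    "num_add E1 = 0" "num_mul E1 = length T" "length E1 \<le> length T * (t + 1)"
    "\<forall>g\<in>set E1. gate_bounded V t g"
    using add_products[OF Cons.prems(1), of T t V] unfolding sigma_pi_def by blast
  define n l where "n = length C" and "l = length E1"
  define X where "X = E1 @ [Add ps]"
  have "ps \<noteq> []"
    using E1(2) T by (auto simp: sigma_pi_def)
  moreover have "\<forall>p\<in>set ps. p < length (C @ E1)"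
    using E1(2) unfolding list_all2_conv_all_nth product_at_def by (metis in_set_conv_nth)
  ultimately have ok: "gates_ok (C @ X)"
    using E1(1) gates_ok_snoc[of "C @ E1" "Add ps"] by (auto simp: X_def)
  have "\<exists>E qs. gates_ok ((C @ X) @ E) \<and> list_all2 (sum_at ((C @ X) @ E)) qs Ts \<and>
    used E + mset qs = mset [length (C @ X)..<length (C @ X) + length E] \<and>
    num_add E = length Ts \<and> num_mul E \<le> length Ts * M \<and>
    length E \<le> length Ts * (M * (t + 1) + 1) \<and> (\<forall>g\<in>set E. gate_bounded V t g)"
    by (rule Cons.IH[OF ok]) (rule Cons.prems(2), simp)
  then obtain E qs where E: "gates_ok ((C @ X) @ E)" "list_all2 (sum_at ((C @ X) @ E)) qs Ts"
    "used E + mset qs = mset [length (C @ X)..<length (C @ X) + length E]"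
    "num_add E = length Ts" "num_mul E \<le> length Ts * M" "length E \<le> length Ts * (M * (t + 1) + 1)"
    "\<forall>g\<in>set E. gate_bounded V t g"
    by blast
  have "list_all2 (product_at (C @ X)) ps T"
    using list_all2_mono[OF E1(2)] product_at_append[of "C @ E1" _ _ "[Add ps]"] by (simp add: X_def)
  then have "sum_at (C @ X) (n + l) T"
    unfolding sum_at_def by (auto simp: n_def l_def X_def nth_append)
  then have "sum_at ((C @ X) @ E) (n + l) T"
    by (rule sum_at_append)
  then have "list_all2 (sum_at (C @ X @ E)) ((n + l) # qs) (T # Ts)"
    using E(2) by simp
  moreover have "used (X @ E) + mset ((n + l) # qs) = mset [n..<n + length (X @ E)]"
  proof -
    have "[n..<n + length (X @ E)] = [n..<n + l] @ [n + l] @ [n + l + 1..<n + l + 1 + length E]"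
      using upt_add_eq_append[of n "n + l" "1 + length E"] upt_conv_Cons[of "n + l" "n + l + 1 + length E"]
      by (simp add: X_def l_def add.assoc)
    then have "mset [n..<n + length (X @ E)]
        = mset [n..<n + l] + {#n + l#} + mset [n + l + 1..<n + l + 1 + length E]"
      by simp
    also have "mset [n + l + 1..<n + l + 1 + length E] = used E + mset qs"
      using E(3) by (simp add: X_def n_def l_def add.assoc)
    also have "mset [n..<n + l] = used X"
      using E1(3) by (simp add: X_def used_singleton n_def l_def del: mset_upt)
    finally show ?thesis
      by (simp add: ac_simps)
  qed
  moreover have "num_add (X @ E) = length (T # Ts)"
    using E E1 by (simp add: X_def) (simp add: num_add_def)
  moreover have "length T \<le> M"
    using T by (simp add: sigma_pi_def)
  then have "num_mul (X @ E) \<le> length (T # Ts) * M"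
    using E E1 by (simp add: X_def) (simp add: num_mul_def)
  moreover have "length (X @ E) \<le> length (T # Ts) * (M * (t + 1) + 1)"
  proof -
    have "length E1 \<le> M * (t + 1)"
      using E1(6) mult_le_mono1[OF \<open>length T \<le> M\<close>] by (rule order_trans)
    then show ?thesis
      using E(6) by (simp add: X_def)
  qed
  moreover have "\<forall>g\<in>set (X @ E). gate_bounded V t g"
    using E(7) E1(7) by (auto simp: X_def gate_bounded_def fan_in_def)
  ultimately show ?case
    using E(1) unfolding n_def append_assoc
    by (intro exI[of _ "X @ E"] exI[of _ "(length C + l) # qs"] conjI)
qed

section \<open>Values and shape of the blocks\<close>

lemma product_at_value:
  assumes "gates_ok C" "product_at C q gs" "\<forall>g\<in>set gs. is_input g"
  shows "circuit_values C ! q = (\<Prod>g\<leftarrow>gs. input_value g)"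
proof -
  have wf: "wf_gates C"
    using assms(1) by (simp add: gates_ok_def)
  obtain as where as: "q < length C" "C ! q = Mul as" "\<forall>a\<in>set as. a < length C" "map ((!) C) as = gs"
    using assms(2) by (auto simp: product_at_def)
  have "circuit_values C ! a = input_value (C ! a)" if "a \<in> set as" for a
  proof -
    have "is_input (C ! a)"
      using that as(4) assms(3) by auto
    then show ?thesis
      using circuit_values_nth[OF wf, of a] as(3) that by (cases "C ! a") auto
  qed
  then have "map ((!) (circuit_values C)) as = map input_value gs"
    by (auto simp flip: as(4))
  then show ?thesis
    using circuit_values_nth[OF wf as(1)] as(2) by simp
qed

lemma sum_at_value:
  assumes "gates_ok C" "sum_at C q T" "\<forall>gs\<in>set T. \<forall>g\<in>set gs. is_input g"
  shows "circuit_values C ! q = sigma_pi_value T"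
proof -
  have wf: "wf_gates C"
    using assms(1) by (simp add: gates_ok_def)
  obtain ps where ps: "q < length C" "C ! q = Add ps" "list_all2 (product_at C) ps T"
    using assms(2) by (auto simp: sum_at_def)
  have "map ((!) (circuit_values C)) ps = map (\<lambda>gs. \<Prod>g\<leftarrow>gs. input_value g) T"
    using ps(3) assms(1,3) by (induction rule: list_all2_induct) (auto intro: product_at_value)
  then show ?thesis
    using circuit_values_nth[OF wf ps(1)] ps(2) by (simp add: sigma_pi_value_def)
qed

lemma sum_at_shape:
  assumes "sum_at C q T" "\<forall>gs\<in>set T. \<forall>g\<in>set gs. is_input g"
  shows "is_add (C ! q) \<and> (\<forall>k\<in>set (args (C ! q)). is_mul (C ! k) \<and> (\<forall>l\<in>set (args (C ! k)). is_input (C ! l)))"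
proof -
  obtain ps where ps: "C ! q = Add ps" "list_all2 (product_at C) ps T"
    using assms(1) by (auto simp: sum_at_def)
  have "is_mul (C ! k) \<and> (\<forall>l\<in>set (args (C ! k)). is_input (C ! l))" if "k \<in> set ps" for k
  proof -
    obtain gs where "gs \<in> set T" "product_at C k gs"
      using ps(2) \<open>k \<in> set ps\<close> by (metis in_set_conv_nth list_all2_conv_all_nth)
    then show ?thesis
      using assms(2) by (fastforce simp: product_at_def)
  qed
  with ps show ?thesis by simp
qed

text \<open>Circuit and formula come from one construction. The lists in \<open>J\<close> are the
  top products, as indices of blocks, and a repeated index shares a block. If the indices run
  through all blocks in order without repetition, every block is used once and fan-out one
  follows.\<close>

lemma depth_four_exists:
  fixes Ts :: "('v, 'k::field) gate list list list"
  assumes Ts: "\<And>T. T \<in> set Ts \<Longrightarrow> sigma_pi V t M T"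
    and J: "J \<noteq> []" "\<And>x. x \<in> set J \<Longrightarrow> x \<noteq> [] \<and> length x \<le> t \<and> (\<forall>i\<in>set x. i < length Ts)"
  shows "\<exists>C. depth_four_circuit C \<and>
    computes C (\<Sum>x\<leftarrow>J. \<Prod>i\<leftarrow>x. sigma_pi_value (Ts ! i)) \<and>
    (\<forall>g\<in>set C. gate_bounded V t g) \<and>
    num_add C = length Ts + 1 \<and> num_mul C \<le> length J + length Ts * M \<and>
    circuit_size C \<le> length Ts * (M * (t + 1) + 1) + length J + 1 \<and>
    (concat J = [0..<length Ts] \<longrightarrow> depth_four_formula C)"
proof -
  have "gates_ok []"
    by (simp add: gates_ok_def wf_gates_def)
  then obtain E qs where E: "gates_ok E" "list_all2 (sum_at E) qs Ts"
    "used E + mset qs = mset [0..<length E]"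
    "num_add E = length Ts" "num_mul E \<le> length Ts * M" "length E \<le> length Ts * (M * (t + 1) + 1)"
    "\<forall>g\<in>set E. gate_bounded V t g"
    using add_sums[of "[]" Ts V t M] Ts unfolding append_Nil list.size(3) add_0 by blast
  define top where "top = map (\<lambda>x. Mul (map ((!) qs) x) :: ('v, 'k) gate) J"
  define out where "out = (Add [length E..<length E + length J] :: ('v, 'k) gate)"
  define C where "C = (E @ top) @ [out]"
  have len: "length qs = length Ts"
    using E(2) by (rule list_all2_lengthD)
  have qs: "sum_at E (qs ! i) (Ts ! i)" if "i < length Ts" for i
    using E(2) that len by (simp add: list_all2_conv_all_nth)
  have inputs: "\<forall>gs\<in>set (Ts ! i). \<forall>g\<in>set gs. is_input g" if "i < length Ts" for i
    using Ts[of "Ts ! i"] that by (simp add: sigma_pi_def)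
  have sum_C: "sum_at C (qs ! i) (Ts ! i)" if "i < length Ts" for i
    using sum_at_append[OF qs[OF that]] by (simp add: C_def)
  have "gates_ok (E @ top)"
  proof (rule gates_ok_append[OF E(1)])
    fix g assume "g \<in> set top"
    then obtain x where "x \<in> set J" "g = Mul (map ((!) qs) x)"
      by (auto simp: top_def)
    then show "(\<forall>j\<in>set (args g). j < length E) \<and> (\<not> is_input g \<longrightarrow> args g \<noteq> [])"
      using J(2)[of x] qs by (auto simp: sum_at_def)
  qed
  then have ok: "gates_ok C"
    using J(1) gates_ok_snoc[of "E @ top" out] by (simp add: C_def out_def top_def)
  then have circ: "is_circuit C"
    by (rule gates_ok_imp_is_circuit) (simp add: C_def)
  have wf: "wf_gates C"
    using ok by (simp add: gates_ok_def)
  have C_top: "C ! (length E + m) = Mul (map ((!) qs) (J ! m))" if "m < length J" for m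
    using that by (simp add: C_def top_def nth_append)
  have last: "last C = out"
    by (simp add: C_def)
  have "depth_four_circuit C"
    unfolding depth_four_circuit_def
  proof (intro conjI circ ballI)
    show "is_add (last C)"
      by (simp add: last out_def)
    fix i assume "i \<in> set (args (last C))"
    then obtain m where m: "m < length J" "i = length E + m"
      by (auto simp: last out_def dest: le_Suc_ex)
    then show "is_mul (C ! i)"
      using C_top by simp
    fix j assume "j \<in> set (args (C ! i))"
    then obtain a where a: "a \<in> set (J ! m)" "j = qs ! a"
      using C_top m by auto
    then have "a < length Ts"
      using J(2)[of "J ! m"] m by simp
    note shape = sum_at_shape[OF sum_C[OF this] inputs[OF this], folded a(2)]
    show "is_add (C ! j)"
      using shape by blast
    fix k assume k: "k \<in> set (args (C ! j))"
    show "is_mul (C ! k)"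
      using shape k by blast
    fix l assume "l \<in> set (args (C ! k))"
    then show "is_input (C ! l)"
      using shape k by blast
  qed
  moreover have "computes C (\<Sum>x\<leftarrow>J. \<Prod>i\<leftarrow>x. sigma_pi_value (Ts ! i))"
  proof -
    let ?v = "circuit_values C"
    have val: "?v ! (length E + m) = (\<Prod>i\<leftarrow>J ! m. sigma_pi_value (Ts ! i))" if m: "m < length J" for m
    proof -
      have "?v ! (qs ! i) = sigma_pi_value (Ts ! i)" if "i \<in> set (J ! m)" for i
        using J(2)[of "J ! m"] m that by (intro sum_at_value[OF ok sum_C inputs]) auto
      then have "map ((!) ?v) (map ((!) qs) (J ! m)) = map (\<lambda>i. sigma_pi_value (Ts ! i)) (J ! m)"
        by simp
      moreover have "length E + m < length C"
        using m by (simp add: C_def top_def)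
      ultimately show ?thesis
        using circuit_values_nth[OF wf, of "length E + m"] C_top[OF m] by (simp add: o_def cong: map_cong)
    qed
    have "?v \<noteq> []"
      using circ by (metis is_circuit_def length_0_conv length_circuit_values)
    then have "last ?v = ?v ! (length C - 1)"
      by (simp add: last_conv_nth)
    also have "\<dots> = gate_value ?v out"
      using circuit_values_nth[OF wf, of "length C - 1"] last_conv_nth[of C] last
      by (simp add: C_def)
    also have "\<dots> = (\<Sum>x\<leftarrow>J. \<Prod>i\<leftarrow>x. sigma_pi_value (Ts ! i))"
    proof -
      have "map ((!) ?v) [length E..<length E + length J] = map (\<lambda>x. \<Prod>i\<leftarrow>x. sigma_pi_value (Ts ! i)) J"
        using val by (intro nth_equalityI) auto
      then show ?thesis
        by (simp add: out_def)
    qed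
    finally show ?thesis
      using circ by (simp add: computes_def)
  qed
  moreover have "\<forall>g\<in>set C. gate_bounded V t g"
    using E(7) J(2) by (auto simp: C_def top_def out_def gate_bounded_def fan_in_def)
  moreover have "num_add top = 0" "num_mul top = length J" "num_add [out] = 1" "num_mul [out] = 0"
    by (simp_all add: top_def out_def num_add_def num_mul_def filter_map o_def)
  then have "num_add C = length Ts + 1" "num_mul C \<le> length J + length Ts * M"
    using E by (simp_all add: C_def)
  moreover have "circuit_size C \<le> length Ts * (M * (t + 1) + 1) + length J + 1"
    using E(6) by (simp add: circuit_size_def C_def top_def)
  moreover have "depth_four_formula C" if "concat J = [0..<length Ts]"
  proof -
    have "used top = mset (concat (map (map ((!) qs)) J))"
      by (simp add: used_def top_def o_def)
    also have "concat (map (map ((!) qs)) J) = map ((!) qs) (concat J)"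
      by (simp add: map_concat)
    also have "\<dots> = qs"
      using that map_nth[of qs] by (simp add: len)
    finally have "used C = mset [0..<length E] + mset [length E..<length E + length J]"
      using E(3) by (simp add: C_def used_singleton out_def del: mset_upt)
    also have "\<dots> = mset [0..<length C - 1]"
      using upt_add_eq_append[of 0 "length E" "length J"] 
      by (simp add: C_def top_def flip: mset_append del: mset_upt)
    finally have "fan_out C i = 1" if "i < length C - 1" for i
      using that by (simp add: fan_out_eq_count_used)
    then show ?thesis
      using \<open>depth_four_circuit C\<close> by (simp add: depth_four_formula_def)
  qed
  ultimately show ?thesis
    by blast
qed

text \<open>Numbers all occurrences of factors consecutively, so that no two occurrences share a
  block.\<close>

lemma consecutive_indices:
  "\<exists>J. concat J = [0..<length (concat xss)] \<and> map (map ((!) (concat xss))) J = xss"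
proof (induction xss rule: rev_induct)
  case (snoc xs xss)
  define n where "n = length (concat xss)"
  obtain J where J: "concat J = [0..<n]" "map (map ((!) (concat xss))) J = xss"
    using snoc by (auto simp: n_def)
  let ?ys = "concat (xss @ [xs])"
  have "map ((!) ?ys) x = map ((!) (concat xss)) x" if "x \<in> set J" for x
  proof -
    have "set x \<subseteq> {0..<n}"
      using that J(1) by (metis UN_upper set_concat set_upt)
    then show ?thesis
      by (auto simp: nth_append n_def)
  qed
  then have "map (map ((!) ?ys)) J = xss"
    using J(2) by (metis map_cong)
  moreover have "map ((!) ?ys) [n..<n + length xs] = xs"
    by (rule nth_equalityI) (auto simp: n_def nth_append)
  moreover have "concat (J @ [[n..<n + length xs]]) = [0..<length ?ys]"
    using J(1) upt_add_eq_append[of 0 n "length xs"] by (simp add: n_def)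
  ultimately show ?case
    by (intro exI[of _ "J @ [[n..<n + length xs]]"]) simp
qed simp

text \<open>The same products are realised twice: with one block per polynomial for the circuit, and
  with one block per occurrence of a factor, at most \<open>(R + 1) * (t + 1)\<close> of them, for
  the formula.\<close>

lemma depth_four_of_sum_of_products:
  fixes f :: "('v, 'k::field) mpoly"
  assumes "finite V" "finite P" and P: "\<And>p. p \<in> P \<Longrightarrow> total_degree p \<le> t \<and> mvars p \<subseteq> V"
    and sop: "sum_of_products P (t + 1) R f" and M: "M = (card V + 1) ^ t + 1"
  shows "\<exists>C. depth_four_circuit C \<and> computes C f \<and> (\<forall>g\<in>set C. gate_bounded V (t + 1) g) \<and>
      num_add C \<le> card P + 2 \<and> num_mul C \<le> (R + 1) + (card P + 1) * M"
    and "\<exists>F. depth_four_formula F \<and> computes F f \<and> (\<forall>g\<in>set F. gate_bounded V (t + 1) g) \<and>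
      circuit_size F \<le> (R + 1) * (t + 1) * (M * (t + 2) + 1) + (R + 1) + 1"
proof -
  obtain J0 where J0: "length J0 \<le> R" "\<forall>x\<in>set J0. length x = t + 1 \<and> set x \<subseteq> P"
    "f = (\<Sum>x\<leftarrow>J0. prod_list x)"
    using sop unfolding sum_of_products_def by blast
  \<comment> \<open>A product of zeros keeps the output gate from having no argument when
    \<open>J0\<close> is empty; it turns \<open>R\<close> into \<open>R + 1\<close>.\<close>
  define J where "J = replicate (t + 1) 0 # J0"
  define P' where "P' = insert 0 P"
  have J: "length J \<le> R + 1" "\<forall>x\<in>set J. length x = t + 1 \<and> set x \<subseteq> P'" "f = (\<Sum>x\<leftarrow>J. prod_list x)" "J \<noteq> []"
    using J0 by (auto simp: J_def P'_def)
  have "total_degree (0 :: ('v, 'k) mpoly) = 0" "mvars (0 :: ('v, 'k) mpoly) = {}"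
    by (simp_all add: total_degree_def mvars_def)
  then have "\<forall>p\<in>P'. \<exists>T. sigma_pi V (t + 1) M T \<and> sigma_pi_value T = p"
    unfolding M P'_def using P assms(1) by (intro ballI sigma_pi_exists) auto
  from bchoice[OF this] obtain \<tau> where \<tau>: "\<forall>p\<in>P'. sigma_pi V (t + 1) M (\<tau> p) \<and> sigma_pi_value (\<tau> p) = p" ..
  obtain ps where ps: "set ps = P'" "distinct ps"
    using finite_distinct_list[of P'] assms(2) by (auto simp: P'_def)
  have "\<forall>p\<in>P'. \<exists>i<length ps. ps ! i = p"
    using ps by (auto simp: in_set_conv_nth)
  from bchoice[OF this] obtain idx where idx: "\<forall>p\<in>P'. idx p < length ps \<and> ps ! idx p = p" ..
  have "length ps = card P'"
    using ps distinct_card by metis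
  then have len_ps: "length ps \<le> card P + 1"
    using assms(2) by (simp add: P'_def card_insert_if)
  \<comment> \<open>Equal factors get equal indices, hence a shared block.\<close>
  define J1 where "J1 = map (map idx) J"
  obtain C where C: "depth_four_circuit C"
    "computes C (\<Sum>x\<leftarrow>J1. \<Prod>i\<leftarrow>x. sigma_pi_value (map \<tau> ps ! i))"
    "\<forall>g\<in>set C. gate_bounded V (t + 1) g"
    "num_add C = length (map \<tau> ps) + 1" "num_mul C \<le> length J1 + length (map \<tau> ps) * M"
    using depth_four_exists[of "map \<tau> ps" V "t + 1" M J1] \<tau> ps idx J
    by (fastforce simp: J1_def)
  have "(\<Sum>x\<leftarrow>J1. \<Prod>i\<leftarrow>x. sigma_pi_value (map \<tau> ps ! i)) = (\<Sum>x\<leftarrow>J. prod_list x)"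
    unfolding J1_def map_map
  proof (intro arg_cong[where f = sum_list] map_cong refl)
    fix x assume "x \<in> set J"
    then have "set x \<subseteq> P'" using J by blast
    then have "map (\<lambda>i. sigma_pi_value (map \<tau> ps ! i)) (map idx x) = x"
      using idx \<tau> by (auto intro!: map_idI)
    then show "((\<lambda>x. \<Prod>i\<leftarrow>x. sigma_pi_value (map \<tau> ps ! i)) \<circ> map idx) x = prod_list x"
      by (simp only: o_apply)
  qed
  then have "computes C f"
    using C(2) J(3) by simp
  moreover have "num_mul C \<le> (R + 1) + (card P + 1) * M"
  proof -
    have "length ps * M \<le> (card P + 1) * M"
      using len_ps by (rule mult_le_mono1)
    then show ?thesis
      using C(5) J(1) by (simp add: J1_def)
  qed
  moreover have "num_add C \<le> card P + 2"
    using C(4) len_ps by simp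
  ultimately show "\<exists>C. depth_four_circuit C \<and> computes C f \<and> (\<forall>g\<in>set C. gate_bounded V (t + 1) g) \<and>
      num_add C \<le> card P + 2 \<and> num_mul C \<le> (R + 1) + (card P + 1) * M"
    using C(1,3) by blast
  \<comment> \<open>For the formula, every occurrence of a factor gets its own block.\<close>
  define qs where "qs = concat J"
  obtain J2 where J2: "concat J2 = [0..<length qs]" "map (map ((!) qs)) J2 = J"
    using consecutive_indices[of J] by (auto simp: qs_def)
  have "set qs \<subseteq> P'"
    using J(2) by (auto simp: qs_def)
  have J2_len: "length J2 = length J"
    using J2(2) by (metis length_map)
  have J2_ok: "x \<noteq> [] \<and> length x \<le> t + 1 \<and> (\<forall>i\<in>set x. i < length (map \<tau> qs))" if x: "x \<in> set J2" for x
  proof -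
    have "map ((!) qs) x \<in> set J"
      using x J2(2) by (metis image_eqI list.set_map)
    then have "length x = t + 1"
      using J(2) by (metis length_map)
    moreover have "set x \<subseteq> {0..<length qs}"
      using x J2(1) by (metis UN_upper set_concat set_upt)
    ultimately show ?thesis by auto
  qed
  obtain F where F: "computes F (\<Sum>x\<leftarrow>J2. \<Prod>i\<leftarrow>x. sigma_pi_value (map \<tau> qs ! i))"
    "\<forall>g\<in>set F. gate_bounded V (t + 1) g" "depth_four_formula F"
    "circuit_size F \<le> length (map \<tau> qs) * (M * (t + 1 + 1) + 1) + length J2 + 1"
  proof -
    have "J2 \<noteq> []"
      using J2_len J(4) by auto
    moreover have "sigma_pi V (t + 1) M T" if "T \<in> set (map \<tau> qs)" for T
      using that \<tau> \<open>set qs \<subseteq> P'\<close> by auto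
    ultimately show ?thesis
      using depth_four_exists[of "map \<tau> qs" V "t + 1" M J2] J2_ok J2(1) that by auto
  qed
  have "(\<Sum>x\<leftarrow>J2. \<Prod>i\<leftarrow>x. sigma_pi_value (map \<tau> qs ! i)) = (\<Sum>x\<leftarrow>J2. prod_list (map ((!) qs) x))"
  proof (intro arg_cong[where f = sum_list] map_cong refl)
    fix x assume "x \<in> set J2"
    then have "\<forall>i\<in>set x. i < length qs"
      using J2_ok by simp
    then have "map (\<lambda>i. sigma_pi_value (map \<tau> qs ! i)) x = map ((!) qs) x"
      using \<tau> subsetD[OF \<open>set qs \<subseteq> P'\<close> nth_mem] by simp
    then show "(\<Prod>i\<leftarrow>x. sigma_pi_value (map \<tau> qs ! i)) = prod_list (map ((!) qs) x)"
      by (simp only:)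
  qed
  also have "\<dots> = (\<Sum>x\<leftarrow>map (map ((!) qs)) J2. prod_list x)"
    by (simp add: o_def)
  also have "\<dots> = f"
    using J2(2) J(3) by simp
  finally have "computes F f"
    using F(1) by simp
  moreover have "circuit_size F \<le> (R + 1) * (t + 1) * (M * (t + 2) + 1) + (R + 1) + 1"
  proof -
    have "length qs = length J * (t + 1)"
      unfolding qs_def using J(2) by (induction J) auto
    then have "length qs \<le> (R + 1) * (t + 1)"
      using J(1) by (metis mult_le_mono1)
    then have "length qs * (M * (t + 2) + 1) \<le> (R + 1) * (t + 1) * (M * (t + 2) + 1)"
      by (rule mult_le_mono1)
    moreover have "circuit_size F \<le> length qs * (M * (t + 2) + 1) + length J + 1"
      using F(4) J2_len by (simp add: add.assoc)
    ultimately show ?thesis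
      using J(1) by linarith
  qed
  ultimately show "\<exists>F. depth_four_formula F \<and> computes F f \<and> (\<forall>g\<in>set F. gate_bounded V (t + 1) g) \<and>
      circuit_size F \<le> (R + 1) * (t + 1) * (M * (t + 2) + 1) + (R + 1) + 1"
    using F(2,3) by blast
qed

section \<open>Counting gates\<close>

lemma add_le_power:
  assumes "(2::nat) \<le> b" "x \<le> b ^ i" "y \<le> b ^ i"
  shows "x + y \<le> b ^ Suc i"
proof -
  have "x + y \<le> 2 * b ^ i"
    using assms by simp
  also have "\<dots> \<le> b * b ^ i"
    using assms(1) by (rule mult_le_mono1)
  finally show ?thesis by simp
qed

lemma Suc_le_power:
  assumes "(2::nat) \<le> b" "x \<le> b ^ i"
  shows "x + 1 \<le> b ^ Suc i"
  by (rule add_le_power) (use assms in auto)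

lemma mult_le_power:
  assumes "x \<le> (b::nat) ^ i" "y \<le> b ^ j"
  shows "x * y \<le> b ^ (i + j)"
  using mult_le_mono[OF assms] by (simp add: power_add)

lemma le_power_trans:
  assumes "(2::nat) \<le> b" "x \<le> b ^ i" "i \<le> j"
  shows "x \<le> b ^ j"
  using assms(2) power_increasing[OF assms(3), of b] assms(1) by linarith

text \<open>\<open>b\<close> bounds circuit size and degree; it will be \<open>n ^ c\<close>. Every
  multiplication by \<open>s\<close> or \<open>d\<close>, and every addition of 1, raises the
  exponent of \<open>b\<close> by one, which gives \<open>b ^ (8 * L)\<close> for \<open>N\<close>.
  The addition gates are of order \<open>N ^ 2\<close>, hence \<open>16 * L\<close> and lower terms;
  the top products contribute \<open>N ^ t\<close>, the monomials \<open>b ^ (2 * t)\<close>. The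
  constants 22 and 24 absorb the lower terms by \<open>L \<ge> 1\<close>.\<close>

lemma gate_count_bounds:
  fixes b s d t L N M R p :: nat
  assumes b: "2 \<le> b" "s \<le> b" "d \<le> b" and t: "t \<le> 3 * d" and L: "1 \<le> L"
    and N: "N = (d * (s * (s * (d + 1) + 1) + 1) + 1) ^ L"
    and p: "p \<le> 2 + (t + 1) * N + (d + 1) * (N * N)"
    and v: "v \<le> s" and M: "M = (v + 1) ^ t + 1" and R: "R = 1 + d * N ^ t"
  shows "p + 2 \<le> b ^ (22 * L)"
    and "(R + 1) + (p + 1) * M \<le> b ^ (24 * L * (t + 1))"
    and "(R + 1) * (t + 1) * (M * (t + 2) + 1) + (R + 1) + 1 \<le> b ^ (24 * L * (t + 1))"
proof -
  note le_trans' = le_power_trans[OF b(1)]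
  note suc = Suc_le_power[OF b(1)]
  have s1: "s \<le> b ^ 1" and d1: "d \<le> b ^ 1"
    using b by auto
  have d2: "d + 1 \<le> b ^ 2"
    using suc[OF d1] by (simp add: numeral_2_eq_2)
  have "s * (d + 1) + 1 \<le> b ^ 4"
    using suc[OF mult_le_power[OF s1 d2]] by (simp add: eval_nat_numeral)
  from suc[OF mult_le_power[OF s1 this]] have "s * (s * (d + 1) + 1) + 1 \<le> b ^ 6"
    by (simp add: eval_nat_numeral)
  from suc[OF mult_le_power[OF d1 this]] have "d * (s * (s * (d + 1) + 1) + 1) + 1 \<le> b ^ 8"
    by (simp add: eval_nat_numeral)
  then have N8: "N \<le> b ^ (8 * L)"
    unfolding N power_mult by (rule power_mono) simp
  have t3: "t + 1 \<le> b ^ 3"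
  proof -
    have "2 * 2 * b \<le> b * b * b"
      using b(1) by (intro mult_le_mono) auto
    moreover have "t + 1 \<le> 2 * 2 * b"
      using t b by linarith
    ultimately show ?thesis
      unfolding power3_eq_cube by (rule order_trans[rotated])
  qed
  have p6: "p \<le> b ^ (16 * L + 5)"
  proof -
    have "(t + 1) * N \<le> b ^ (16 * L + 3)"
      by (rule le_trans'[OF mult_le_power[OF t3 N8]]) simp
    moreover have "(d + 1) * (N * N) \<le> b ^ (16 * L + 4)"
      by (rule le_trans'[OF mult_le_power[OF d2 mult_le_power[OF N8 N8]]]) simp
    moreover have "2 \<le> b ^ (16 * L + 3)"
      by (rule le_trans'[of _ 1]) (use b in auto)
    ultimately have "2 + (t + 1) * N + (d + 1) * (N * N) \<le> b ^ Suc (16 * L + 4)"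
      using add_le_power[OF b(1), of 2 "16 * L + 3" "(t + 1) * N"]
        add_le_power[OF b(1), of "2 + (t + 1) * N" "16 * L + 4" "(d + 1) * (N * N)"]
      by (simp add: numeral_eq_Suc)
    then show ?thesis
      using p by (simp add: numeral_eq_Suc)
  qed
  have "2 \<le> b ^ (16 * L + 5)"
    by (rule le_trans'[of _ 1]) (use b in auto)
  from add_le_power[OF b(1) p6 this] show "p + 2 \<le> b ^ (22 * L)"
    by (rule le_trans') (use L in auto)
  have p7: "p + 1 \<le> b ^ (16 * L + 6)"
    using suc[OF p6] by (simp add: numeral_eq_Suc)
  have "N ^ t \<le> b ^ (8 * L * t)"
    unfolding power_mult using N8 by (simp add: power_mono power_mult)
  from suc[OF mult_le_power[OF d1 this]] have "R \<le> b ^ (8 * L * t + 2)"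
    by (simp add: R)
  from suc[OF this] have R3: "R + 1 \<le> b ^ (8 * L * t + 3)"
    by (simp add: numeral_eq_Suc)
  have "v + 1 \<le> b ^ 2"
    using suc[of v 1] v b by (simp add: numeral_2_eq_2)
  then have "(v + 1) ^ t \<le> b ^ (2 * t)"
    unfolding power_mult by (rule power_mono) simp
  from suc[OF this] have M1: "M \<le> b ^ (2 * t + 1)"
    by (simp add: M)
  have Lt: "t \<le> L * t"
    using L by simp
  have eqs: "24 * L * (t + 1) = 24 * (L * t) + 24 * L" "8 * L * t = 8 * (L * t)"
    by (simp_all add: algebra_simps)
  show "(R + 1) + (p + 1) * M \<le> b ^ (24 * L * (t + 1))"
  proof -
    have "R + 1 \<le> b ^ (8 * L * t + 16 * L + 2 * t + 7)"
      by (rule le_trans'[OF R3]) simp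
    moreover have "(p + 1) * M \<le> b ^ (8 * L * t + 16 * L + 2 * t + 7)"
      by (rule le_trans'[OF mult_le_power[OF p7 M1]]) simp
    ultimately have "(R + 1) + (p + 1) * M \<le> b ^ Suc (8 * L * t + 16 * L + 2 * t + 7)"
      by (rule add_le_power[OF b(1)])
    then show ?thesis
      by (rule le_trans') (use L Lt eqs in linarith)
  qed
  show "(R + 1) * (t + 1) * (M * (t + 2) + 1) + (R + 1) + 1 \<le> b ^ (24 * L * (t + 1))"
  proof -
    have t4: "t + 2 \<le> b ^ 4"
      using suc[OF t3] by (simp add: eval_nat_numeral)
    have "M * (t + 2) + 1 \<le> b ^ (2 * t + 6)"
      using suc[OF mult_le_power[OF M1 t4]] by (simp add: numeral_eq_Suc)
    from mult_le_power[OF mult_le_power[OF R3 t3] this]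
    have "(R + 1) * (t + 1) * (M * (t + 2) + 1) \<le> b ^ (8 * L * t + 2 * t + 12)"
      by (rule le_trans') simp
    moreover have "R + 1 \<le> b ^ (8 * L * t + 2 * t + 12)"
      by (rule le_trans'[OF R3]) simp
    ultimately have "(R + 1) * (t + 1) * (M * (t + 2) + 1) + (R + 1) \<le> b ^ Suc (8 * L * t + 2 * t + 12)"
      by (rule add_le_power[OF b(1)])
    from suc[OF this] show ?thesis
      by (rule le_trans') (use L Lt eqs in linarith)
  qed
qed

text \<open>For \<open>n \<ge> 2\<close> the sum of the absolute coefficients is absorbed by
  \<open>2 ^ e \<le> n ^ e\<close>. The exponent is made positive so that \<open>n ^ c\<close> is
  itself at least 2.\<close>

lemma poly_le_power:
  fixes p :: "real poly"
  shows "\<exists>c\<ge>1. \<forall>n\<ge>2. poly p (real n) \<le> real (n ^ c)"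
proof -
  define A where "A = (\<Sum>i\<le>degree p. \<bar>coeff p i\<bar>)"
  obtain e :: nat where "A < 2 ^ e"
    using real_arch_pow[of 2 A] by auto
  have "poly p (real n) \<le> real (n ^ (e + degree p + 1))" if n: "n \<ge> 2" for n :: nat
  proof -
    have "poly p (real n) = (\<Sum>i\<le>degree p. coeff p i * real n ^ i)"
      by (rule poly_altdef)
    also have "\<dots> \<le> (\<Sum>i\<le>degree p. \<bar>coeff p i\<bar> * real n ^ degree p)"
    proof (rule sum_mono)
      fix i assume "i \<in> {..degree p}"
      then have "real n ^ i \<le> real n ^ degree p"
        using n by (intro power_increasing) auto
      then show "coeff p i * real n ^ i \<le> \<bar>coeff p i\<bar> * real n ^ degree p"
        by (intro mult_mono) auto
    qed
    also have "\<dots> = A * real n ^ degree p"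
      by (simp add: A_def sum_distrib_right)
    also have "\<dots> \<le> real n ^ e * real n ^ degree p"
    proof (intro mult_right_mono)
      have "(2::real) ^ e \<le> real n ^ e"
        using n by (intro power_mono) auto
      then show "A \<le> real n ^ e"
        using \<open>A < 2 ^ e\<close> by linarith
    qed simp
    also have "\<dots> \<le> real n ^ (e + degree p + 1)"
      unfolding power_add[symmetric] using n by (intro power_increasing) auto
    finally show ?thesis by simp
  qed
  then show ?thesis
    by (intro exI[of _ "e + degree p + 1"]) auto
qed

text \<open>The construction sees one polynomial only. \<open>n\<close> and \<open>c\<close> enter
  through the estimates alone, so they are quantified after \<Gamma> and \<open>F\<close>.\<close>

lemma depth_four_of_computes:
  fixes f :: "('v, 'k::field) mpoly"
  assumes C: "computes C f"
  shows "\<exists>\<Gamma> F. depth_four_circuit \<Gamma> \<and> computes \<Gamma> f \<and> input_vars \<Gamma> \<subseteq> mvars f \<and>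
    (\<forall>g\<in>set \<Gamma>. is_mul g \<longrightarrow> real (fan_in g) \<le> sqrt (3 * real (total_degree f)) + 1) \<and>
    depth_four_formula F \<and> computes F f \<and> input_vars F \<subseteq> mvars f \<and>
    (\<forall>g\<in>set F. is_mul g \<longrightarrow> real (fan_in g) \<le> sqrt (3 * real (total_degree f)) + 1) \<and>
    (\<forall>n\<ge>2. \<forall>c\<ge>1. length C \<le> n ^ c \<longrightarrow> total_degree f \<le> n ^ c \<longrightarrow>
      real (num_add \<Gamma>) \<le> real n powr (44 * real c * log 2 (deg2 f)) \<and>
      real (num_mul \<Gamma>) \<le> real n powr (144 * real c * (sqrt (deg2 f) * log 2 (deg2 f))) \<and>
      real (circuit_size F) \<le> real n powr (144 * real c * (sqrt (deg2 f) * log 2 (deg2 f))))"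
proof -
  define d where "d = total_degree f"
  define \<delta> where "\<delta> = deg2 f"
  have \<delta>: "\<delta> \<ge> 2" "real d \<le> \<delta>"
    by (auto simp: \<delta>_def deg2_def d_def)
  define t where "t = nat \<lfloor>sqrt (3 * real d)\<rfloor>"
  have t_le: "real t \<le> sqrt (3 * real d)"
    unfolding t_def by (simp add: of_nat_floor)
  have t_gt: "sqrt (3 * real d) < real t + 1"
    unfolding t_def by linarith
  have t_sq: "t ^ 2 \<le> 3 * d"
  proof -
    have "real t ^ 2 \<le> 3 * real d"
      using power_mono[OF t_le, of 2] by simp
    then have "real (t ^ 2) \<le> real (3 * d)"
      by simp
    then show ?thesis
      by (simp only: of_nat_le_iff)
  qed
  have t_Suc_sq: "3 * d < (t + 1) ^ 2"
  proof -
    have "3 * real d < (real t + 1) ^ 2"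
      using power_strict_mono[OF t_gt, of 2] by simp
    then have "real (3 * d) < real ((t + 1) ^ 2)"
      by (simp add: add.commute)
    then show ?thesis
      by (simp only: of_nat_less_iff)
  qed
  have t3d: "t \<le> 3 * d"
    using t_sq le_square[of t] unfolding power2_eq_square by linarith
  \<comment> \<open>For \<open>d > 0\<close> the floor \<open>t\<close> is at least 1, so
    \<open>3 * d < (t + 1) ^ 2 \<le> 2 * t * (t + 1)\<close>, which leaves room to spare.\<close>
  have dt: "d \<le> Suc t * t"
  proof (cases "d = 0")
    case False
    then have "t \<noteq> 0"
      using t_Suc_sq by (cases "t = 0") auto
    then have "t + 1 \<le> 2 * t"
      by simp
    then have "(t + 1) ^ 2 \<le> (t + 1) * (2 * t)"
      by (simp add: power2_eq_square)
    then show ?thesis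
      using t_Suc_sq by simp
  qed simp
  \<comment> \<open>The floor is increased by 1 for the strict \<open>d < 2 ^ L\<close>; since
    \<open>log 2 \<delta> \<ge> 1\<close>, the result is at most twice the logarithm.\<close>
  define L where "L = nat \<lfloor>log 2 \<delta>\<rfloor> + 1"
  have log1: "log 2 \<delta> \<ge> 1"
    using \<delta>(1) by simp
  have L: "1 \<le> L" "real L \<le> 2 * log 2 \<delta>"
    using log1 by (auto simp: L_def) linarith
  have dL: "d < 2 ^ L"
  proof -
    have "log 2 \<delta> < real L"
      using log1 by (simp add: L_def) linarith
    then have "\<delta> < 2 powr real L"
      using \<delta>(1) by (simp add: log_less_iff)
    then have "real d < 2 ^ L"
      using \<delta>(2) by (simp only: powr_realpow zero_less_numeral)
    then show ?thesis
      by simp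
  qed
  define V where "V = mvars f"
  define N where "N = (d * (length C * (length C * (d + 1) + 1) + 1) + 1) ^ L"
  define M where "M = (card V + 1) ^ t + 1"
  define R where "R = 1 + d * N ^ t"
  obtain P where P: "finite P" "card P \<le> 2 + (t + 1) * N + (d + 1) * (N * N)"
    "\<And>p. p \<in> P \<Longrightarrow> total_degree p \<le> t \<and> mvars p \<subseteq> V" "sum_of_products P (t + 1) R f"
    using computes_imp_sum_of_products[OF C _ dt dL N_def] by (auto simp: d_def V_def R_def)
  have V: "finite V" "card V \<le> length C"
    using card_mvars_le[OF C] by (simp_all add: V_def)
  obtain \<Gamma> where \<Gamma>: "depth_four_circuit \<Gamma>" "computes \<Gamma> f" "\<forall>g\<in>set \<Gamma>. gate_bounded V (t + 1) g"
    "num_add \<Gamma> \<le> card P + 2" "num_mul \<Gamma> \<le> (R + 1) + (card P + 1) * M"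
    using depth_four_of_sum_of_products(1)[OF V(1) P(1,3,4) M_def] by blast
  obtain F where F: "depth_four_formula F" "computes F f" "\<forall>g\<in>set F. gate_bounded V (t + 1) g"
    "circuit_size F \<le> (R + 1) * (t + 1) * (M * (t + 2) + 1) + (R + 1) + 1"
    using depth_four_of_sum_of_products(2)[OF V(1) P(1,3,4) M_def] by blast
  have bounded: "input_vars E \<subseteq> mvars f \<and>
      (\<forall>g\<in>set E. is_mul g \<longrightarrow> real (fan_in g) \<le> sqrt (3 * real (total_degree f)) + 1)"
    if E: "\<forall>g\<in>set E. gate_bounded V (t + 1) g" for E :: "('v, 'k) circuit"
  proof (intro conjI ballI impI)
    show "input_vars E \<subseteq> mvars f"
      using E by (auto simp: input_vars_def gate_bounded_def V_def)
    fix g assume "g \<in> set E" "is_mul g"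
    then have "fan_in g \<le> t + 1"
      using E by (auto simp: gate_bounded_def)
    then have "real (fan_in g) \<le> real t + 1"
      by linarith
    then show "real (fan_in g) \<le> sqrt (3 * real (total_degree f)) + 1"
      using t_le by (simp add: d_def)
  qed
  \<comment> \<open>44 is 22 * 2, by \<open>L \<le> 2 * log 2 \<delta>\<close>; 144 is 24 * 2 * 3,
    by that and \<open>t + 1 \<le> 3 * sqrt \<delta>\<close>.\<close>
  have exps: "real (22 * L) \<le> 44 * log 2 \<delta>"
    "real (24 * L * (t + 1)) \<le> 144 * (sqrt \<delta> * log 2 \<delta>)"
  proof -
    show "real (22 * L) \<le> 44 * log 2 \<delta>"
      using L by simp
    have "real t \<le> 2 * sqrt \<delta>"
    proof -
      have "sqrt (3 * real d) \<le> sqrt (4 * \<delta>)"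
        using \<delta> by (intro real_sqrt_le_mono) linarith
      then show ?thesis
        using t_le by (simp add: real_sqrt_mult)
    qed
    moreover have "1 \<le> sqrt \<delta>"
      using \<delta> by simp
    ultimately have "real (t + 1) \<le> 3 * sqrt \<delta>"
      unfolding of_nat_add of_nat_1 by linarith
    then have "real L * real (t + 1) \<le> (2 * log 2 \<delta>) * (3 * sqrt \<delta>)"
      using L log1 by (intro mult_mono) auto
    then show "real (24 * L * (t + 1)) \<le> 144 * (sqrt \<delta> * log 2 \<delta>)"
      by (simp add: algebra_simps)
  qed
  have to_powr: "real x \<le> real n powr (A * real c * y)"
    if "x \<le> (n ^ c) ^ i" "real i \<le> A * y" "n \<ge> 2" for x n c i :: nat and A y :: real
  proof -
    have "real x \<le> real ((n ^ c) ^ i)"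
      using that(1) by (simp only: of_nat_le_iff)
    also have "\<dots> = real n powr (real c * real i)"
      using that(3) by (simp flip: power_mult powr_realpow)
    also have "\<dots> \<le> real n powr (A * real c * y)"
    proof (rule powr_mono)
      have "real c * real i \<le> real c * (A * y)"
        using that(2) by (rule mult_left_mono) simp
      then show "real c * real i \<le> A * real c * y"
        by (simp add: mult_ac)
    qed (use that in simp)
    finally show ?thesis .
  qed
  have sizes: "real (num_add \<Gamma>) \<le> real n powr (44 * real c * log 2 \<delta>) \<and>
      real (num_mul \<Gamma>) \<le> real n powr (144 * real c * (sqrt \<delta> * log 2 \<delta>)) \<and>
      real (circuit_size F) \<le> real n powr (144 * real c * (sqrt \<delta> * log 2 \<delta>))"
    if n: "n \<ge> 2" "c \<ge> 1" "length C \<le> n ^ c" "d \<le> n ^ c" for n c :: nat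
  proof -
    have "n ^ 1 \<le> n ^ c"
      using n by (intro power_increasing) auto
    then have "2 \<le> n ^ c"
      using n by simp
    note bds = gate_count_bounds[OF this n(3,4) t3d L(1) N_def P(2) V(2) M_def R_def]
    show ?thesis
      using le_trans[OF \<Gamma>(4) bds(1)] le_trans[OF \<Gamma>(5) bds(2)] le_trans[OF F(4) bds(3)] exps n(1)
      by (intro conjI to_powr) blast+
  qed
  show ?thesis
    using \<Gamma>(1,2) bounded[OF \<Gamma>(3)] F(1,2) bounded[OF F(3)] sizes unfolding \<delta>_def d_def
    by (intro exI[of _ \<Gamma>] exI[of _ F]) blast
qed

theorem theorem5:
  fixes f :: "nat \<Rightarrow> ('v, 'k::field) mpoly"
  assumes "f \<in> VP"
  shows "(\<exists>\<Gamma> a m.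
            a \<in> O(\<lambda>n. log 2 (deg2 (f n))) \<and>
            m \<in> O(\<lambda>n. sqrt (deg2 (f n)) * log 2 (deg2 (f n))) \<and>
            (\<forall>n. depth_four_circuit (\<Gamma> n) \<and> computes (\<Gamma> n) (f n) \<and>
                 input_vars (\<Gamma> n) \<subseteq> mvars (f n) \<and>
                 (\<forall>g\<in>set (\<Gamma> n). is_mul g \<longrightarrow>
                    real (fan_in g) \<le> sqrt (3 * real (total_degree (f n))) + 1)) \<and>
            (\<forall>n\<ge>2. real (num_add (\<Gamma> n)) \<le> real n powr a n \<and>
                    real (num_mul (\<Gamma> n)) \<le> real n powr m n)) \<and>
         (\<exists>F s.
            s \<in> O(\<lambda>n. sqrt (deg2 (f n)) * log 2 (deg2 (f n))) \<and>
            (\<forall>n. depth_four_formula (F n) \<and> computes (F n) (f n) \<and>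
                 input_vars (F n) \<subseteq> mvars (f n) \<and>
                 (\<forall>g\<in>set (F n). is_mul g \<longrightarrow>
                    real (fan_in g) \<le> sqrt (3 * real (total_degree (f n))) + 1)) \<and>
            (\<forall>n\<ge>2. real (circuit_size (F n)) \<le> real n powr s n))"
proof -
  obtain p :: "real poly" and C where C: "\<And>n. computes (C n) (f n)"
    "\<And>n. real (circuit_size (C n)) \<le> poly p (real n)" "\<And>n. real (total_degree (f n)) \<le> poly p (real n)"
    using assms unfolding VP_def by blast
  obtain c where c: "c \<ge> 1" "\<And>n. n \<ge> 2 \<Longrightarrow> poly p (real n) \<le> real (n ^ c)"
    using poly_le_power[of p] by blast
  define a where "a n = 44 * real c * log 2 (deg2 (f n))" for n
  define m where "m n = 144 * real c * (sqrt (deg2 (f n)) * log 2 (deg2 (f n)))" for n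
  have small: "length (C n) \<le> n ^ c" "total_degree (f n) \<le> n ^ c" if "n \<ge> 2" for n
    using C(2,3)[of n] c(2)[OF that] by (simp_all add: circuit_size_def flip: of_nat_le_iff of_nat_power)
  \<comment> \<open>Circuit and formula are chosen together as a pair, since one application of
    \<open>depth_four_of_computes\<close> yields both.\<close>
  have "\<forall>n. \<exists>\<Gamma>F. depth_four_circuit (fst \<Gamma>F) \<and> computes (fst \<Gamma>F) (f n) \<and> input_vars (fst \<Gamma>F) \<subseteq> mvars (f n) \<and>
    (\<forall>g\<in>set (fst \<Gamma>F). is_mul g \<longrightarrow> real (fan_in g) \<le> sqrt (3 * real (total_degree (f n))) + 1) \<and>
    depth_four_formula (snd \<Gamma>F) \<and> computes (snd \<Gamma>F) (f n) \<and> input_vars (snd \<Gamma>F) \<subseteq> mvars (f n) \<and>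
    (\<forall>g\<in>set (snd \<Gamma>F). is_mul g \<longrightarrow> real (fan_in g) \<le> sqrt (3 * real (total_degree (f n))) + 1) \<and>
    (n \<ge> 2 \<longrightarrow> real (num_add (fst \<Gamma>F)) \<le> real n powr a n \<and> real (num_mul (fst \<Gamma>F)) \<le> real n powr m n \<and>
      real (circuit_size (snd \<Gamma>F)) \<le> real n powr m n)" (is "\<forall>n. \<exists>X. ?Q n X")
  proof
    fix n
    from depth_four_of_computes[OF C(1)[of n]] obtain \<Gamma> F where *:
      "depth_four_circuit \<Gamma>" "computes \<Gamma> (f n)" "input_vars \<Gamma> \<subseteq> mvars (f n)"
      "\<forall>g\<in>set \<Gamma>. is_mul g \<longrightarrow> real (fan_in g) \<le> sqrt (3 * real (total_degree (f n))) + 1"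
      "depth_four_formula F" "computes F (f n)" "input_vars F \<subseteq> mvars (f n)"
      "\<forall>g\<in>set F. is_mul g \<longrightarrow> real (fan_in g) \<le> sqrt (3 * real (total_degree (f n))) + 1"
      and bd: "\<forall>n'\<ge>2. \<forall>c\<ge>1. length (C n) \<le> n' ^ c \<longrightarrow> total_degree (f n) \<le> n' ^ c \<longrightarrow>
        real (num_add \<Gamma>) \<le> real n' powr (44 * real c * log 2 (deg2 (f n))) \<and>
        real (num_mul \<Gamma>) \<le> real n' powr (144 * real c * (sqrt (deg2 (f n)) * log 2 (deg2 (f n)))) \<and>
        real (circuit_size F) \<le> real n' powr (144 * real c * (sqrt (deg2 (f n)) * log 2 (deg2 (f n))))"
      by (elim exE conjE)
    have "n \<ge> 2 \<longrightarrow> real (num_add \<Gamma>) \<le> real n powr a n \<and> real (num_mul \<Gamma>) \<le> real n powr m n \<and>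
      real (circuit_size F) \<le> real n powr m n"
      using bd[rule_format, OF _ c(1)] small unfolding a_def m_def by blast
    with * show "\<exists>X. ?Q n X"
      by (intro exI[of _ "(\<Gamma>, F)"]) simp
  qed
  from choice[OF this] obtain X where X: "\<forall>n. ?Q n (X n)" ..
  have a: "a \<in> O(\<lambda>n. log 2 (deg2 (f n)))"
    unfolding a_def by (rule bigoI[of _ "44 * real c"]) (simp add: abs_mult)
  have m: "m \<in> O(\<lambda>n. sqrt (deg2 (f n)) * log 2 (deg2 (f n)))"
    unfolding m_def by (rule bigoI[of _ "144 * real c"]) (simp add: abs_mult)
  show ?thesis
  proof (intro conjI)
    show "\<exists>\<Gamma> a m. a \<in> O(\<lambda>n. log 2 (deg2 (f n))) \<and>
            m \<in> O(\<lambda>n. sqrt (deg2 (f n)) * log 2 (deg2 (f n))) \<and>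
            (\<forall>n. depth_four_circuit (\<Gamma> n) \<and> computes (\<Gamma> n) (f n) \<and>
                 input_vars (\<Gamma> n) \<subseteq> mvars (f n) \<and>
                 (\<forall>g\<in>set (\<Gamma> n). is_mul g \<longrightarrow>
                    real (fan_in g) \<le> sqrt (3 * real (total_degree (f n))) + 1)) \<and>
            (\<forall>n\<ge>2. real (num_add (\<Gamma> n)) \<le> real n powr a n \<and>
                    real (num_mul (\<Gamma> n)) \<le> real n powr m n)"
      using a m X by (intro exI[of _ "\<lambda>n. fst (X n)"] exI[of _ a] exI[of _ m]) blast
    show "\<exists>F s. s \<in> O(\<lambda>n. sqrt (deg2 (f n)) * log 2 (deg2 (f n))) \<and>
            (\<forall>n. depth_four_formula (F n) \<and> computes (F n) (f n) \<and>
                 input_vars (F n) \<subseteq> mvars (f n) \<and>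
                 (\<forall>g\<in>set (F n). is_mul g \<longrightarrow>
                    real (fan_in g) \<le> sqrt (3 * real (total_degree (f n))) + 1)) \<and>
            (\<forall>n\<ge>2. real (circuit_size (F n)) \<le> real n powr s n)"
      using m X by (intro exI[of _ "\<lambda>n. snd (X n)"] exI[of _ m]) blast
  qed
qed

end
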